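(* Let $m\ge 1$, let $r,p,q$ be non-negative integers with $p\le q$ and $r+2q\le m$, and let $k\ge 0$ be an integer. Then $$\dim MT^{(r,p,q)}_k=\sum_{j=p}^{q} d(k,m,r+2j)+\sum_{j=p}^{q-1} d(k-1,m,r+2j+1),$$ where the numbers $d(k,m,s)$ are given as follows: for $1\le s\le m-1$ and $k\ge 0$, $$d(k,m,s)=\binom{m-2}{s-1}\binom{k+m-2}{m-2}\frac{(2k+m)(k+m-1)}{(k+s)(k+m-s)};$$ $d(0,m,s)=1$ for $s\in\{0,m\}$; $d(k,m,s)=0$ for $k\ge 1$ and $s\in\{0,m\}$; and $d(-1,m,s)=0$ for all $s$.
   Context: For $k\ge 0$, $\mathcal P_k$ is the space of real-valued polynomials on $\mathbf R^m$ homogeneous of degree $k$. For $0\le s\le m$, $\mathcal P^s_k=\mathcal P_k\otimes_{\mathbf R}\Lambda^s(\mathbf R^m)$ is the space of differential $s$-forms on $\mathbf R^m$ whose coefficients are in $\mathcal P_k$. The operator $d$ is the de Rham differential and $d^*$ its formal adjoint (the codifferential) with respect to the Euclidean metric. Put $$\mathcal P^{(r,p,q)}_k=\bigoplus_{j=p}^q\mathcal P^{r+2j}_k,\qquad MT^{(r,p,q)}_k=\{P\in\mathcal P^{(r,p,q)}_k:\ (d+d^* )P=0\}.$$ Dimensions are over $\mathbf R$, and an empty sum is $0$. *)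

theory Defs
  imports "HOL-Analysis.Analysis" "HOL-Library.Function_Algebras"
begin

section \<open>Homogeneous polynomials and differential forms on Euclidean space\<close>

definition homogeneous_polys :: "nat \<Rightarrow> (real ^ 'n \<Rightarrow> real) set" where
  "homogeneous_polys k =
     {f. real_polynomial_function f \<and> (\<forall>t x. f (t *\<^sub>R x) = t ^ k * f x)}"

text \<open>
  The exterior algebra of \<open>\<real>\<^sup>m\<close>, \<open>m = CARD('n)\<close>, is represented by \<open>real ^ ('n set)\<close>: the coordinate
  of \<open>v\<close> at \<open>I = {i\<^sub>1 < \<dots> < i\<^sub>s}\<close> is the coefficient of \<open>dx\<^sub>i\<^sub>1 \<and> \<dots> \<and> dx\<^sub>i\<^sub>s\<close>. These monomials are
  orthonormal for the inner product that the Euclidean metric induces on the exterior algebra, so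
  that inner product is the standard one of \<open>real ^ ('n set)\<close>.  The linear order of the index
  type \<open>'n\<close> is used only to fix the signs; the types of \<open>Numeral_Type\<close> provide
  such an index type of every positive cardinality.
\<close>

type_synonym 'n exterior = "real ^ ('n set)"
type_synonym 'n form = "real ^ 'n \<Rightarrow> 'n exterior"

definition sgn_pos :: "'n::{finite,linorder} \<Rightarrow> 'n set \<Rightarrow> real" where
  "sgn_pos i I = (-1) ^ card {j \<in> I. j < i}"

text \<open>Exterior multiplication \<open>v \<mapsto> dx\<^sub>i \<and> v\<close>, and contraction of \<open>v\<close> with the \<open>i\<close>-th basis vector.\<close>

definition wedge_dx :: "'n::{finite,linorder} \<Rightarrow> 'n exterior \<Rightarrow> 'n exterior" where
  "wedge_dx i v = (\<chi> I. if i \<in> I then sgn_pos i I * v $ (I - {i}) else 0)"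

definition contract :: "'n::{finite,linorder} \<Rightarrow> 'n exterior \<Rightarrow> 'n exterior" where
  "contract i v = (\<chi> I. if i \<in> I then 0 else sgn_pos i I * v $ (insert i I))"

definition partial_deriv :: "'n \<Rightarrow> (real ^ 'n \<Rightarrow> 'b::real_normed_vector) \<Rightarrow> real ^ 'n \<Rightarrow> 'b" where
  "partial_deriv i f x = frechet_derivative f (at x) (axis i 1)"

definition ext_deriv :: "'n::{finite,linorder} form \<Rightarrow> 'n form" where
  "ext_deriv \<omega> = (\<lambda>x. \<Sum>i\<in>UNIV. wedge_dx i (partial_deriv i \<omega> x))"

text \<open>That this is the formal adjoint of \<open>ext_deriv\<close> is lemma \<open>codiff_formal_adjoint\<close> below.\<close>

definition codiff :: "'n::{finite,linorder} form \<Rightarrow> 'n form" where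
  "codiff \<omega> = (\<lambda>x. - (\<Sum>i\<in>UNIV. contract i (partial_deriv i \<omega> x)))"

definition poly_forms :: "nat \<Rightarrow> nat \<Rightarrow> 'n::{finite,linorder} form set" where
  "poly_forms k s =
     {\<omega>. \<forall>I. (\<lambda>x. \<omega> x $ I) \<in> homogeneous_polys k \<and> (card I \<noteq> s \<longrightarrow> (\<forall>x. \<omega> x $ I = 0))}"

definition mixed_poly_forms :: "nat \<Rightarrow> nat \<Rightarrow> nat \<Rightarrow> nat \<Rightarrow> 'n::{finite,linorder} form set" where
  "mixed_poly_forms r p q k =
     {(\<lambda>x. \<Sum>j=p..q. \<omega> j x) | \<omega>. \<forall>j\<in>{p..q}. \<omega> j \<in> poly_forms k (r + 2 * j)}"

definition MT :: "nat \<Rightarrow> nat \<Rightarrow> nat \<Rightarrow> nat \<Rightarrow> 'n::{finite,linorder} form set" where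
  "MT r p q k = {P \<in> mixed_poly_forms r p q k. \<forall>x. ext_deriv P x + codiff P x = 0}"

text \<open>The real vector space of functions with values in a real vector space.\<close>

definition fun_scaleR :: "real \<Rightarrow> ('a \<Rightarrow> 'b::real_vector) \<Rightarrow> 'a \<Rightarrow> 'b" where
  "fun_scaleR c f = (\<lambda>x. c *\<^sub>R f x)"

global_interpretation fun_vs: vector_space "fun_scaleR :: real \<Rightarrow> ('a \<Rightarrow> 'b::real_vector) \<Rightarrow> 'a \<Rightarrow> 'b"
  by unfold_locales (auto simp: fun_scaleR_def plus_fun_def algebra_simps)

text \<open>The degree is an integer because degree \<open>-1\<close> occurs.\<close>

definition dim_formula :: "int \<Rightarrow> nat \<Rightarrow> nat \<Rightarrow> real" where
  "dim_formula k m s =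
     (if k < 0 then 0
      else if 1 \<le> s \<and> s < m then
        real ((m - 2) choose (s - 1)) * real ((nat k + m - 2) choose (m - 2)) *
        ((2 * of_int k + real m) * (of_int k + real m - 1) /
         ((of_int k + real s) * (of_int k + real m - real s)))
      else if k = 0 \<and> (s = 0 \<or> s = m) then 1
      else 0)"


section \<open>The codifferential is the formal adjoint of the exterior derivative\<close>

lemma sgn_pos_insert: "i \<notin> I \<Longrightarrow> sgn_pos i (insert i I) = sgn_pos i I"
  unfolding sgn_pos_def by (rule arg_cong[where f = "\<lambda>A. (-1) ^ card A"]) auto

lemma linear_wedge_dx: "linear (wedge_dx i)"
  by (intro linearI) (auto simp: wedge_dx_def vec_eq_iff algebra_simps)

lemma linear_contract: "linear (contract i)"
  by (intro linearI) (auto simp: contract_def vec_eq_iff algebra_simps)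

lemma wedge_dx_adjoint: "wedge_dx i v \<bullet> w = v \<bullet> contract i w"
proof -
  have "wedge_dx i v \<bullet> w = (\<Sum>I\<in>UNIV. if i \<in> I then sgn_pos i I * v $ (I - {i}) * w $ I else 0)"
    by (simp add: inner_vec_def wedge_dx_def if_distrib if_distribR cong: if_cong)
  also have "\<dots> = (\<Sum>I\<in>{I. i \<in> I}. sgn_pos i I * v $ (I - {i}) * w $ I)"
    by (simp add: sum.If_cases)
  also have "\<dots> = (\<Sum>I\<in>{I. i \<notin> I}. v $ I * (sgn_pos i I * w $ insert i I))"
    by (rule sum.reindex_bij_witness[where i = "insert i" and j = "\<lambda>I. I - {i}"])
       (auto simp: insert_absorb sgn_pos_insert[symmetric])
  also have "\<dots> = (\<Sum>I\<in>UNIV. if i \<in> I then 0 else v $ I * (sgn_pos i I * w $ insert i I))"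
    by (simp add: sum.If_cases Compl_eq)
  also have "\<dots> = v \<bullet> contract i w"
    by (simp add: inner_vec_def contract_def if_distrib if_distribR cong: if_cong)
  finally show ?thesis .
qed

definition C1_fun :: "(real ^ 'n \<Rightarrow> 'b::real_normed_vector) \<Rightarrow> bool" where
  "C1_fun f \<longleftrightarrow> (\<forall>x. f differentiable (at x)) \<and> (\<forall>i. continuous_on UNIV (partial_deriv i f))"

definition compactly_supported :: "('a::topological_space \<Rightarrow> 'b::zero) \<Rightarrow> bool" where
  "compactly_supported f \<longleftrightarrow> (\<exists>K. compact K \<and> (\<forall>x. x \<notin> K \<longrightarrow> f x = 0))"

lemma C1_fun_has_derivative:
  "C1_fun f \<Longrightarrow> (f has_derivative frechet_derivative f (at x)) (at x)"
  by (simp add: C1_fun_def frechet_derivative_works)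

lemma C1_fun_continuous: "C1_fun f \<Longrightarrow> continuous_on UNIV f"
  by (metis C1_fun_has_derivative continuous_at_imp_continuous_on has_derivative_continuous)

lemma partial_deriv_eqI: "(f has_derivative f') (at x) \<Longrightarrow> partial_deriv i f x = f' (axis i 1)"
  by (simp add: partial_deriv_def frechet_derivative_at[symmetric])

lemma has_vector_derivative_along_axis:
  assumes "C1_fun f"
  shows "((\<lambda>t. f (x + t *\<^sub>R axis i 1)) has_vector_derivative partial_deriv i f (x + t *\<^sub>R axis i 1)) (at t)"
proof -
  let ?D = "frechet_derivative f (at (x + t *\<^sub>R axis i 1))"
  have "((\<lambda>t. x + t *\<^sub>R axis i 1) has_derivative (\<lambda>h. h *\<^sub>R axis i 1)) (at t)"
    by (auto intro!: derivative_eq_intros)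
  from diff_chain_at[OF this C1_fun_has_derivative[OF assms]]
  have "((\<lambda>t. f (x + t *\<^sub>R axis i 1)) has_derivative (\<lambda>h. ?D (h *\<^sub>R axis i 1))) (at t)"
    by (simp add: o_def)
  moreover have "linear ?D"
    using C1_fun_has_derivative[OF assms] by (rule has_derivative_linear)
  ultimately show ?thesis
    by (simp add: has_vector_derivative_def partial_deriv_def linear_scale)
qed

lemma partial_deriv_zero_off_support:
  assumes "closed K" "\<And>x. x \<notin> K \<Longrightarrow> f x = 0" "x \<notin> K"
  shows "partial_deriv i f x = 0"
proof -
  have "(f has_derivative (\<lambda>h. 0)) (at x)"
  proof (rule has_derivative_transform_within_open)
    show "((\<lambda>x. 0) has_derivative (\<lambda>h. 0)) (at x)" by simp
    show "open (- K)" using assms by auto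
  qed (use assms in auto)
  then show ?thesis by (simp add: partial_deriv_eqI)
qed

lemma lborel_integral_translate:
  fixes f :: "real ^ 'n \<Rightarrow> real"
  assumes [measurable]: "f \<in> borel_measurable borel"
  shows "(LINT x|lborel. f (x + a)) = (LINT x|lborel. f x)"
proof -
  have "(LINT x|lborel. f x) = (LINT x|distr lborel borel ((+) a). f x)"
    by (simp add: lborel_distr_plus)
  also have "\<dots> = (LINT x|lborel. f (a + x))"
    by (rule integral_distr) auto
  finally show ?thesis by (simp add: add.commute)
qed

lemma integrable_compactly_supported:
  fixes f :: "real ^ 'n \<Rightarrow> real"
  assumes "continuous_on UNIV f" "compact K" "\<And>x. x \<notin> K \<Longrightarrow> f x = 0"
  shows "integrable lborel f"
proof -
  have "integrable lborel (\<lambda>x. indicator K x *\<^sub>R f x)"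
    using borel_integrable_compact[OF assms(2), of f] assms(1) continuous_on_subset by blast
  also have "(\<lambda>x. indicator K x *\<^sub>R f x) = f"
    using assms(3) by (auto simp: fun_eq_iff indicator_def)
  finally show ?thesis .
qed

lemma integral_partial_deriv_eq_0:
  fixes f :: "real ^ 'n \<Rightarrow> real"
  assumes C1: "C1_fun f" and K: "compact K" "\<And>x. x \<notin> K \<Longrightarrow> f x = 0"
  shows "(LINT x|lborel. partial_deriv i f x) = 0"
proof -
  define e :: "real ^ 'n" where "e = axis i 1"
  define g where "g = partial_deriv i f"
  define t :: "nat \<Rightarrow> real" where "t n = 1 / Suc n" for n
  define s where "s n x = (f (x + t n *\<^sub>R e) - f x) / t n" for n x
  have t: "t n > 0" "t n \<le> 1" for n by (auto simp: t_def)
  have norm_e: "norm e = 1" by (simp add: e_def)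
  have cont_g: "continuous_on UNIV g" using C1 by (simp add: C1_fun_def g_def)
  have cont_f: "continuous_on UNIV f" using C1 by (rule C1_fun_continuous)
  have [measurable]: "f \<in> borel_measurable borel" "g \<in> borel_measurable borel"
    using cont_f cont_g by (auto intro: borel_measurable_continuous_onI)
  have g0: "g x = 0" if "x \<notin> K" for x
    using partial_deriv_zero_off_support[OF compact_imp_closed[OF K(1)] K(2) that] by (simp add: g_def)
  obtain M where M: "\<And>x. x \<in> K \<Longrightarrow> norm (g x) \<le> M"
    using compact_continuous_image[OF continuous_on_subset[OF cont_g subset_UNIV] K(1)]
    by (meson bounded_iff compact_imp_bounded imageI)
  define M' where "M' = max M 0"
  have M': "\<bar>g x\<bar> \<le> M'" for x using M[of x] g0[of x] by (cases "x \<in> K") (auto simp: M'_def)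
  obtain R where R: "\<And>x. x \<in> K \<Longrightarrow> norm x \<le> R"
    using compact_imp_bounded[OF K(1)] by (auto simp: bounded_iff)
  have int_f: "integrable lborel f" by (rule integrable_compactly_supported[OF cont_f K])
  have int_f': "integrable lborel (\<lambda>x. f (x + a))" for a
  proof (rule integrable_compactly_supported)
    show "continuous_on UNIV (\<lambda>x. f (x + a))"
      by (rule continuous_on_compose2[OF cont_f]) (auto intro!: continuous_intros)
    show "compact ((+) (- a) ` K)" using K(1) by (rule compact_translation)
    show "f (x + a) = 0" if "x \<notin> (+) (- a) ` K" for x
      using that K(2)[of "x + a"] by (force simp: image_iff)
  qed
  have int0: "(LINT x|lborel. s n x) = 0" for n
    using int_f int_f'[of "t n *\<^sub>R e"] lborel_integral_translate[of f "t n *\<^sub>R e"]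
    by (simp add: s_def)
  have "(\<lambda>n. LINT x|lborel. s n x) \<longlonglongrightarrow> (LINT x|lborel. g x)"
  proof (rule integral_dominated_convergence[where w = "\<lambda>x. indicator (cball 0 (R + 1)) x * M'"])
    show "g \<in> borel_measurable lborel" "\<And>n. s n \<in> borel_measurable lborel"
      unfolding s_def by measurable
    have "integrable lborel (\<lambda>x::real^'n. indicator (cball 0 (R + 1)) x *\<^sub>R M')"
      by (rule borel_integrable_compact) auto
    then show "integrable lborel (\<lambda>x::real^'n. indicator (cball 0 (R + 1)) x * M')" by simp
    show "AE x in lborel. (\<lambda>n. s n x) \<longlonglongrightarrow> g x"
    proof (rule AE_I2)
      fix x :: "real ^ 'n"
      have "((\<lambda>h. f (x + h *\<^sub>R e)) has_field_derivative g x) (at 0)"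
        using has_vector_derivative_along_axis[OF C1, of x i 0]
        by (simp add: has_real_derivative_iff_has_vector_derivative e_def g_def)
      then have "((\<lambda>h. (f (x + h *\<^sub>R e) - f x) / h) \<longlongrightarrow> g x) (at 0)"
        by (simp add: DERIV_def)
      moreover have "t \<longlonglongrightarrow> 0"
        using LIMSEQ_inverse_real_of_nat by (simp add: t_def[abs_def] inverse_eq_divide)
      then have "filterlim t (at 0) sequentially"
        unfolding filterlim_at using t(1) by (auto simp: less_imp_neq[THEN not_sym])
      ultimately show "(\<lambda>n. s n x) \<longlonglongrightarrow> g x"
        unfolding s_def by (rule filterlim_compose)
    qed
    show "AE x in lborel. norm (s n x) \<le> indicator (cball 0 (R + 1)) x * M'" for n
    proof (rule AE_I2)
      fix x :: "real ^ 'n"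
      show "norm (s n x) \<le> indicator (cball 0 (R + 1)) x * M'"
      proof (cases "x \<in> cball 0 (R + 1)")
        case True
        have "\<exists>z. 0 < z \<and> z < t n \<and>
            f (x + t n *\<^sub>R e) - f (x + 0 *\<^sub>R e) = (t n - 0) * g (x + z *\<^sub>R e)"
        proof (rule MVT2)
          show "0 < t n" by (rule t)
          fix h
          show "((\<lambda>h. f (x + h *\<^sub>R e)) has_real_derivative g (x + h *\<^sub>R e)) (at h)"
            using has_vector_derivative_along_axis[OF C1, of x i h]
            by (simp add: has_real_derivative_iff_has_vector_derivative e_def g_def)
        qed
        then obtain z where "f (x + t n *\<^sub>R e) - f x = t n * g (x + z *\<^sub>R e)" by auto
        then have "s n x = g (x + z *\<^sub>R e)" using t(1)[of n] by (simp add: s_def)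
        then show ?thesis using True M' by simp
      next
        case False
        have "norm x \<le> norm (x + t n *\<^sub>R e) + norm (t n *\<^sub>R e)"
          by (metis add_diff_cancel norm_triangle_ineq4)
        then have "norm x \<le> norm (x + t n *\<^sub>R e) + 1" using t[of n] norm_e by simp
        then have "x + t n *\<^sub>R e \<notin> K" "x \<notin> K" using False R[of x] R[of "x + t n *\<^sub>R e"] by auto
        then show ?thesis using False K(2) by (simp add: s_def)
      qed
    qed
  qed
  then show ?thesis by (simp add: int0 LIMSEQ_const_iff g_def)
qed

theorem codiff_formal_adjoint:
  fixes \<omega> \<eta> :: "'n::{finite,linorder} form"
  assumes \<omega>: "C1_fun \<omega>" and \<eta>: "C1_fun \<eta>"
    and supp: "compactly_supported \<omega> \<or> compactly_supported \<eta>"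
  shows "(LINT x|lborel. ext_deriv \<omega> x \<bullet> \<eta> x) = (LINT x|lborel. \<omega> x \<bullet> codiff \<eta> x)"
proof -
  obtain K where K: "compact K" "(\<forall>x. x \<notin> K \<longrightarrow> \<omega> x = 0) \<or> (\<forall>x. x \<notin> K \<longrightarrow> \<eta> x = 0)"
    using supp by (auto simp: compactly_supported_def)
  define h where "h i x = \<omega> x \<bullet> contract i (\<eta> x)" for i x
  define a where "a i x = partial_deriv i \<omega> x \<bullet> contract i (\<eta> x)" for i x
  define b where "b i x = \<omega> x \<bullet> contract i (partial_deriv i \<eta> x)" for i x
  have bl: "bounded_linear (contract i)" for i :: 'n
    using linear_contract linear_conv_bounded_linear by blast
  have cont: "continuous_on UNIV (\<lambda>x. contract i (f x))"
    if "continuous_on UNIV f" for i and f :: "'n form"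
    using bounded_linear.continuous_on[OF bl that] .
  have cw: "continuous_on UNIV \<omega>" and ce: "continuous_on UNIV \<eta>"
    using \<omega> \<eta> by (auto intro: C1_fun_continuous)
  have dw: "continuous_on UNIV (partial_deriv i \<omega>)" and de: "continuous_on UNIV (partial_deriv i \<eta>)" for i
    using \<omega> \<eta> by (auto simp: C1_fun_def)
  have deriv_h: "(h i has_derivative (\<lambda>v. \<omega> x \<bullet> contract i (frechet_derivative \<eta> (at x) v) +
      frechet_derivative \<omega> (at x) v \<bullet> contract i (\<eta> x))) (at x)" for i x
    unfolding h_def
    by (intro has_derivative_inner bounded_linear.has_derivative[OF bl]
        C1_fun_has_derivative[OF \<omega>] C1_fun_has_derivative[OF \<eta>])
  have partial_h: "partial_deriv j (h i) x =
      \<omega> x \<bullet> contract i (partial_deriv j \<eta> x) + partial_deriv j \<omega> x \<bullet> contract i (\<eta> x)" for i j x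
    using partial_deriv_eqI[OF deriv_h] by (simp add: partial_deriv_def)
  have C1_h: "C1_fun (h i)" for i
    unfolding C1_fun_def
  proof (intro conjI allI)
    show "h i differentiable at x" for x using deriv_h by (auto simp: differentiable_def)
    show "continuous_on UNIV (partial_deriv j (h i))" for j
      unfolding partial_h[abs_def] by (intro continuous_intros cont cw ce dw de)
  qed
  have lin0: "contract i 0 = 0" for i :: 'n by (rule linear_0[OF linear_contract])
  have offK: "h i x = 0" "a i x = 0" "b i x = 0" if "x \<notin> K" for i x
    using K(2) that partial_deriv_zero_off_support[OF compact_imp_closed[OF K(1)] _ that, of \<omega> i]
      partial_deriv_zero_off_support[OF compact_imp_closed[OF K(1)] _ that, of \<eta> i]
    by (auto simp: h_def a_def b_def lin0)
  have int_a: "integrable lborel (a i)" for i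
    using K(1) offK(2) unfolding a_def
    by (intro integrable_compactly_supported continuous_intros cont ce dw) auto
  have int_b: "integrable lborel (b i)" for i
    using K(1) offK(3) unfolding b_def
    by (intro integrable_compactly_supported continuous_intros cont cw de) auto
  have "(LINT x|lborel. a i x) = - (LINT x|lborel. b i x)" for i
  proof -
    have "0 = (LINT x|lborel. partial_deriv i (h i) x)"
      using integral_partial_deriv_eq_0[OF C1_h K(1) offK(1)] by simp
    also have "\<dots> = (LINT x|lborel. b i x + a i x)"
      by (simp add: partial_h a_def b_def)
    also have "\<dots> = (LINT x|lborel. b i x) + (LINT x|lborel. a i x)"
      using int_a int_b by simp
    finally show ?thesis by simp
  qed
  then have "(LINT x|lborel. (\<Sum>i\<in>UNIV. a i x)) = (LINT x|lborel. - (\<Sum>i\<in>UNIV. b i x))"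
    using int_a int_b by (simp add: sum_negf)
  moreover have "(\<Sum>i\<in>UNIV. a i x) = ext_deriv \<omega> x \<bullet> \<eta> x" for x
    by (simp add: a_def ext_deriv_def inner_sum_left wedge_dx_adjoint)
  moreover have "- (\<Sum>i\<in>UNIV. b i x) = \<omega> x \<bullet> codiff \<eta> x" for x
    by (simp add: b_def codiff_def inner_sum_right)
  ultimately show ?thesis by simp
qed

end

theory Submission
  imports Defs
begin

text \<open>
  Let \<open>x\<close> be the Euler field.  Cartan's formula shows that \<open>d \<iota>\<^sub>x + \<iota>\<^sub>x d\<close> acts on \<open>s\<close>-forms with
  coefficients of degree \<open>k\<close> as multiplication by \<open>k + s\<close>, and its Hodge dual shows that
  \<open>d\<^sup>* x\<and> + x\<and> d\<^sup>*\<close> acts as \<open>-(k + m - s)\<close>.  Hence the polynomial de Rham complex is exact, which gives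
  the dimensions of the spaces of closed and of coclosed forms by recursion on \<open>k\<close>.  Since the
  Laplacian \<open>-(d d\<^sup>* + d\<^sup>* d)\<close> is onto, every form is the sum of a closed and a coclosed one, so \<open>d\<^sup>*\<close> maps
  the closed \<open>s\<close>-forms of degree \<open>k\<close> onto the coclosed \<open>(s - 1)\<close>-forms of degree \<open>k - 1\<close>.  Its kernel,
  the forms that are closed and coclosed, therefore has dimension \<open>d(k,m,s)\<close>.

  A solution \<open>P\<close> of \<open>(d + d\<^sup>*)P = 0\<close> satisfies \<open>d P\<^sub>t = - d\<^sup>* P\<^sub>u\<close> with \<open>u = t + 2\<close> for its parts.  These links are closed and
  coclosed forms of degree \<open>k - 1\<close>, all of them occur (through \<open>\<iota>\<^sub>x\<close> and \<open>x\<and>\<close>), and once they vanish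
  every part is itself closed and coclosed.  This accounts for the two sums.
\<close>

subsection \<open>Linear algebra\<close>

text \<open>\<open>ext_deriv\<close> and \<open>codiff\<close> are linear only where Frechet
  derivatives exist, and the space of all functions is infinite-dimensional. Beyond the count of
  monomials, every dimension is therefore found by rank-nullity on a subspace of polynomial forms,
  with linearity assumed on that subspace alone. The Laplacian is needed for the following reason.
  For a coclosed \<open>\<eta>\<close>, the homotopy formula for \<open>wedge_x\<close> gives a
  preimage under \<open>codiff\<close>, but this preimage is in general not closed. Splitting it
  into a closed and a coclosed form repairs this, because \<open>codiff\<close> does not see the
  coclosed part. The links of a solution are independent of each other because each has a lift with
  at most two nonzero parts, a coclosed lower one and a closed upper one: a single link can be
  switched on without producing another. For \<open>s \<le> m\<close>, the homotopy factor
  \<open>k + s\<close> vanishes only at \<open>k = s = 0\<close>, and \<open>k + m - s\<close> only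
  at \<open>k = 0\<close>, \<open>s = m\<close>; these are the places where
  \<open>dim_formula\<close> has its exceptional value 1.\<close>

lemma (in vector_space_pair) subspace_kernel_on:
  assumes V: "vs1.subspace V"
    and add: "\<And>x y. x \<in> V \<Longrightarrow> y \<in> V \<Longrightarrow> f (x + y) = f x + f y"
    and scale: "\<And>c x. x \<in> V \<Longrightarrow> f (s1 c x) = s2 c (f x)"
  shows "vs1.subspace {v \<in> V. f v = 0}"
proof (rule vs1.subspaceI)
  have "f (s1 0 0) = s2 0 (f 0)" by (rule scale) (rule vs1.subspace_0[OF V])
  then show "0 \<in> {v \<in> V. f v = 0}" using vs1.subspace_0[OF V] by simp
qed (use V in \<open>auto simp: add scale vs1.subspace_add vs1.subspace_scale\<close>)

text \<open>Linearity is assumed on \<open>V\<close> only, so the proof trades \<open>f\<close> for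
  a total linear map \<open>g\<close> that agrees with \<open>f\<close> on a basis \<open>C\<close>
  of \<open>V\<close>, hence on \<open>V\<close>. \<open>C\<close> extends a basis \<open>K\<close>
  of the kernel, and \<open>C - K\<close> is mapped to a basis of the image. The finite
  \<open>B\<close> serves to make \<open>C\<close> finite.\<close>

lemma (in vector_space_pair) rank_nullity:
  assumes V: "vs1.subspace V" and B: "finite B" "V \<subseteq> vs1.span B"
    and add: "\<And>x y. x \<in> V \<Longrightarrow> y \<in> V \<Longrightarrow> f (x + y) = f x + f y"
    and scale: "\<And>c x. x \<in> V \<Longrightarrow> f (s1 c x) = s2 c (f x)"
  shows "vs1.dim V = vs1.dim {v \<in> V. f v = 0} + vs2.dim (f ` V)"
proof -
  let ?N = "{v \<in> V. f v = 0}"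
  obtain K where K: "K \<subseteq> ?N" "vs1.independent K" "?N \<subseteq> vs1.span K"
    using vs1.maximal_independent_subset by blast
  have "K \<subseteq> V" using K(1) by auto
  from vs1.maximal_independent_subset_extend[OF this K(2)]
  obtain C where C: "K \<subseteq> C" "C \<subseteq> V" "vs1.independent C" "V \<subseteq> vs1.span C" by metis
  have finC: "finite C"
    using vs1.independent_span_bound[OF B(1) C(3)] C(2) B(2) by auto
  have spanC: "vs1.span C = V" by (rule vs1.span_subspace[OF C(2,4) V])
  obtain g where g: "Vector_Spaces.linear s1 s2 g" "\<And>x. x \<in> C \<Longrightarrow> g x = f x"
    using linear_independent_extend[OF C(3)] by blast
  interpret g: Vector_Spaces.linear s1 s2 g by (rule g)
  have gf: "g x = f x" if "x \<in> V" for x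
  proof -
    have "x \<in> vs1.span C" using that spanC by simp
    then have "x \<in> V \<and> g x = f x"
    proof (induction rule: vs1.span_induct_alt)
      case base
      have "f (s1 0 0) = s2 0 (f 0)" by (rule scale) (rule vs1.subspace_0[OF V])
      then show ?case using vs1.subspace_0[OF V] by (simp add: g.zero)
    next
      case (step c x y)
      then have "x \<in> V" using C(2) by auto
      then show ?case using step V g(2)
        by (simp add: vs1.subspace_add vs1.subspace_scale g.add g.scale add scale)
    qed
    then show ?thesis by simp
  qed
  have inj: "inj_on g (vs1.span (C - K))"
  proof (subst g.inj_on_iff_eq_0)
    show "\<forall>x\<in>vs1.span (C - K). g x = 0 \<longrightarrow> x = 0"
    proof (intro ballI impI)
      fix x assume x: "x \<in> vs1.span (C - K)" "g x = 0"
      have "x \<in> V" using x(1) spanC vs1.span_mono[of "C - K" C] by auto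
      then have "x \<in> vs1.span K" using K(3) x(2) gf by auto
      then obtain w where w: "x = (\<Sum>v\<in>K. s1 (w v) v)"
        using vs1.span_finite[of K] finite_subset[OF C(1) finC] by auto
      obtain u where u: "x = (\<Sum>v\<in>C - K. s1 (u v) v)"
        using x(1) vs1.span_finite[of "C - K"] finC by auto
      \<comment> \<open>Subtracting the expansion of \<open>x\<close> over \<open>K\<close> from
        that over \<open>C - K\<close> gives a linear relation on \<open>C\<close>.\<close>
      define c where "c v = (if v \<in> K then - w v else u v)" for v
      have "(\<Sum>v\<in>C. s1 (c v) v) = (\<Sum>v\<in>C - K. s1 (c v) v) + (\<Sum>v\<in>K. s1 (c v) v)"
        by (rule sum.subset_diff[OF C(1) finC])
      also have "(\<Sum>v\<in>C - K. s1 (c v) v) = x" unfolding u by (rule sum.cong) (auto simp: c_def)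
      also have "(\<Sum>v\<in>K. s1 (c v) v) = - x"
        unfolding w sum_negf[symmetric] by (rule sum.cong) (auto simp: c_def)
      finally have "(\<Sum>v\<in>C. s1 (c v) v) = 0" by simp
      then have "c v = 0" if "v \<in> C" for v
        using vs1.independentD[OF C(3) finC subset_refl _ that] by simp
      then have "u v = 0" if "v \<in> C - K" for v using that unfolding c_def by (metis Diff_iff)
      then show "x = 0" unfolding u by simp
    qed
  qed simp
  have "vs2.independent (g ` (C - K))"
    by (rule g.independent_injective_image[OF vs1.independent_mono[OF C(3)] inj]) auto
  moreover have "f ` V \<subseteq> vs2.span (g ` (C - K))"
  proof
    fix y assume "y \<in> f ` V"
    then obtain x where x: "x \<in> V" "y = g x" using gf by auto
    have "x \<in> vs1.span (K \<union> (C - K))" using x(1) C(1,4) by (auto simp: Un_absorb1)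
    then obtain a b where ab: "x = a + b" "a \<in> vs1.span K" "b \<in> vs1.span (C - K)"
      unfolding vs1.span_Un by blast
    have "g a = 0"
      by (rule g.eq_0_on_span[OF _ ab(2)]) (use K(1) gf in auto)
    then have "y = g b" by (simp add: x(2) ab(1) g.add)
    then show "y \<in> vs2.span (g ` (C - K))" using ab(3) by (simp add: g.span_image)
  qed
  moreover have "g ` (C - K) \<subseteq> f ` V" using C(2) gf by force
  ultimately have "card (g ` (C - K)) = vs2.dim (f ` V)"
    by (intro vs2.basis_card_eq_dim)
  moreover have "card (g ` (C - K)) = card (C - K)"
    using inj_on_subset[OF inj vs1.span_superset] by (rule card_image)
  moreover have "card K = vs1.dim ?N" using K by (intro vs1.basis_card_eq_dim)
  moreover have "card C = vs1.dim V" using C by (intro vs1.basis_card_eq_dim)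
  moreover have "card C = card K + card (C - K)"
    using C(1) finC by (metis card_Un_disjoint Diff_disjoint Un_Diff_cancel Un_absorb1 finite_Diff finite_subset)
  ultimately show ?thesis by simp
qed

text \<open>The basis is an indexed family, so coefficients belong to indices and not to vectors;
  independence in this form already forces \<open>b\<close> to be injective on
  \<open>A\<close>.\<close>

lemma (in vector_space) dim_eq_card_of_coordinates:
  assumes A: "finite A" and V: "V = {\<Sum>a\<in>A. scale (c a) (b a) | c. True}"
    and indep: "\<And>c a. (\<Sum>a\<in>A. scale (c a) (b a)) = 0 \<Longrightarrow> a \<in> A \<Longrightarrow> c a = 0"
  shows "dim V = card A" "\<exists>B. finite B \<and> V \<subseteq> span B"
proof -
  have inj: "inj_on b A"
  proof (rule inj_onI, rule ccontr)
    fix x y assume xy: "x \<in> A" "y \<in> A" "b x = b y" "x \<noteq> y"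
    \<comment> \<open>Two indices with the same vector would satisfy the relation with coefficients
      1 and -1.\<close>
    define c where "c = (\<lambda>a. if a = x then 1 else if a = y then - 1 else 0 :: 'a)"
    have "(\<Sum>a\<in>A. scale (c a) (b a)) = (\<Sum>a\<in>{x, y}. scale (c a) (b a))"
      using A xy(1,2) by (intro sum.mono_neutral_right) (auto simp: c_def)
    also have "\<dots> = 0" using xy by (simp add: c_def)
    finally show False using indep[of c x] xy(1) by (simp add: c_def)
  qed
  have Vim: "V = span (b ` A)"
  proof -
    have "span (b ` A) = range (\<lambda>u. \<Sum>a\<in>A. scale (u (b a)) (b a))"
      using A by (simp add: span_finite sum.reindex[OF inj] o_def)
    also have "\<dots> = V"
    proof
      show "V \<subseteq> range (\<lambda>u. \<Sum>a\<in>A. scale (u (b a)) (b a))"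
      proof
        fix v assume "v \<in> V"
        then obtain c where "v = (\<Sum>a\<in>A. scale (c a) (b a))" unfolding V by auto
        also have "\<dots> = (\<Sum>a\<in>A. scale ((c \<circ> the_inv_into A b) (b a)) (b a))"
          by (rule sum.cong) (auto simp: the_inv_into_f_f[OF inj])
        finally show "v \<in> range (\<lambda>u. \<Sum>a\<in>A. scale (u (b a)) (b a))" by blast
      qed
    qed (auto simp: V)
    finally show ?thesis by simp
  qed
  have "u (b x) = 0" if "(\<Sum>v\<in>b ` A. scale (u v) v) = 0" "x \<in> A" for u x
    using indep[of "u \<circ> b" x] that by (simp add: sum.reindex[OF inj] o_def)
  then have "independent (b ` A)"
    using A by (subst dependent_finite) auto
  then show "dim V = card A" by (simp add: Vim dim_eq_card_independent card_image inj)
  show "\<exists>B. finite B \<and> V \<subseteq> span B" using A Vim by blast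
qed

lemma sum_fun_apply: "sum F A x = (\<Sum>a\<in>A. F a x)"
  for F :: "'a \<Rightarrow> 'b \<Rightarrow> 'c::comm_monoid_add"
  by (induction A rule: infinite_finite_induct) auto

subsection \<open>Partial derivatives\<close>

lemma partial_deriv_add:
  assumes "f differentiable at x" "g differentiable at x"
  shows "partial_deriv i (\<lambda>x. f x + g x) x = partial_deriv i f x + partial_deriv i g x"
  using assms unfolding frechet_derivative_works
  by (subst partial_deriv_eqI[OF has_derivative_add]) (auto simp: partial_deriv_def)

lemma partial_deriv_scaleR:
  fixes g :: "real ^ 'n \<Rightarrow> 'b::real_normed_vector"
  assumes "f differentiable at x" "g differentiable at x"
  shows "partial_deriv i (\<lambda>x. f x *\<^sub>R g x) x = f x *\<^sub>R partial_deriv i g x + partial_deriv i f x *\<^sub>R g x"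
  using assms unfolding frechet_derivative_works
  by (subst partial_deriv_eqI[OF has_derivative_scaleR]) (auto simp: partial_deriv_def)

lemma partial_deriv_sum:
  assumes "\<And>a. a \<in> A \<Longrightarrow> f a differentiable at x"
  shows "partial_deriv i (\<lambda>x. \<Sum>a\<in>A. f a x) x = (\<Sum>a\<in>A. partial_deriv i (f a) x)"
  using assms unfolding frechet_derivative_works
  by (subst partial_deriv_eqI[OF has_derivative_sum]) (auto simp: partial_deriv_def)

lemma partial_deriv_bounded_linear:
  assumes "bounded_linear L" "f differentiable at x"
  shows "partial_deriv i (\<lambda>x. L (f x)) x = L (partial_deriv i f x)"
  using assms(2) unfolding frechet_derivative_works
  by (subst partial_deriv_eqI[OF bounded_linear.has_derivative[OF assms(1)]])
     (auto simp: partial_deriv_def)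

lemma partial_deriv_const: "partial_deriv i (\<lambda>x. c) x = 0"
  by (rule partial_deriv_eqI[OF has_derivative_const, THEN trans]) simp

lemma partial_deriv_linear:
  assumes "bounded_linear f"
  shows "partial_deriv i f x = f (axis i 1)"
  using bounded_linear_imp_has_derivative[OF assms] by (rule partial_deriv_eqI)

lemma partial_deriv_coordinate:
  "partial_deriv i (\<lambda>x. x $ j) x = (if i = j then 1 else 0 :: real)"
  by (simp add: partial_deriv_linear bounded_linear_vec_nth axis_def)

lemma partial_deriv_mult_poly:
  fixes f g :: "real ^ 'n \<Rightarrow> real"
  assumes "real_polynomial_function f" "real_polynomial_function g"
  shows "partial_deriv i (\<lambda>x. f x * g x) = (\<lambda>x. f x * partial_deriv i g x + partial_deriv i f x * g x)"
  using assms partial_deriv_scaleR[of f _ g]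
  by (intro ext) (simp add: differentiable_at_real_polynomial_function)

lemma partial_deriv_add_poly:
  fixes f g :: "real ^ 'n \<Rightarrow> real"
  assumes "real_polynomial_function f" "real_polynomial_function g"
  shows "partial_deriv i (\<lambda>x. f x + g x) = (\<lambda>x. partial_deriv i f x + partial_deriv i g x)"
  using assms by (intro ext partial_deriv_add) (simp_all add: differentiable_at_real_polynomial_function)

lemma partial_deriv_linear':
  "bounded_linear f \<Longrightarrow> partial_deriv i f = (\<lambda>x. f (axis i 1))"
  by (intro ext partial_deriv_linear)

lemma real_polynomial_function_partial_deriv:
  "real_polynomial_function f \<Longrightarrow> real_polynomial_function (partial_deriv i f)"
proof (induction rule: real_polynomial_function.induct)
  case (linear f)
  then show ?case by (simp add: partial_deriv_linear' real_polynomial_function.intros)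
next
  case (const c)
  then show ?case by (simp add: partial_deriv_const[abs_def] real_polynomial_function.intros)
next
  case (add f g)
  then show ?case by (simp add: partial_deriv_add_poly real_polynomial_function.intros)
next
  case (mult f g)
  then show ?case by (simp add: partial_deriv_mult_poly real_polynomial_function.intros)
qed

text \<open>Structural induction replaces the analytic theorem on mixed second derivatives; in the
  product case the derivatives of the factors are again polynomials, so the sum and product rules
  apply a second time.\<close>

lemma partial_deriv_commute_poly:
  "real_polynomial_function f \<Longrightarrow>
    partial_deriv i (partial_deriv j f) = partial_deriv j (partial_deriv i f)"
proof (induction rule: real_polynomial_function.induct)
  case (linear f)
  then show ?case by (simp add: partial_deriv_linear' partial_deriv_const[abs_def])
next
  case (const c)
  then show ?case by (simp add: partial_deriv_const[abs_def])
next
  case (add f g)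
  then show ?case by (simp add: partial_deriv_add_poly real_polynomial_function_partial_deriv)
next
  case (mult f g)
  then show ?case
    by (simp add: partial_deriv_mult_poly partial_deriv_add_poly
        real_polynomial_function_partial_deriv real_polynomial_function.intros algebra_simps)
qed

subsection \<open>Monomials\<close>

definition monomial :: "('n \<Rightarrow> nat) \<Rightarrow> real ^ 'n \<Rightarrow> real" where
  "monomial \<alpha> x = (\<Prod>i\<in>UNIV. x $ i ^ \<alpha> i)"

definition multi_indices :: "nat \<Rightarrow> ('n::finite \<Rightarrow> nat) set" where
  "multi_indices k = {\<alpha>. sum \<alpha> UNIV = k}"

lemma real_polynomial_function_coordinate: "real_polynomial_function (\<lambda>x. x $ i)"
  by (rule real_polynomial_function.intros) (rule bounded_linear_vec_nth)

lemma real_polynomial_function_monomial: "real_polynomial_function (monomial \<alpha>)"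
  unfolding monomial_def[abs_def]
  by (intro real_polynomial_function_prod real_polynomial_function_power
      real_polynomial_function_coordinate) auto

lemma monomial_add: "monomial (\<lambda>i. \<alpha> i + \<beta> i) x = monomial \<alpha> x * monomial \<beta> x"
  by (simp add: monomial_def power_add prod.distrib)

lemma monomial_scaleR: "monomial \<alpha> (t *\<^sub>R x) = t ^ sum \<alpha> UNIV * monomial \<alpha> x"
  by (simp add: monomial_def power_mult_distrib prod.distrib power_sum)

lemma monomial_zero: "monomial (\<lambda>i. 0) x = 1"
  by (simp add: monomial_def)

lemma monomial_coordinate: "monomial (\<lambda>j. if j = i then 1 else 0) x = x $ i"
proof -
  have "monomial (\<lambda>j. if j = i then 1 else 0) x = (\<Prod>j\<in>UNIV. if j = i then x $ j else 1)"
    unfolding monomial_def by (rule prod.cong) auto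
  then show ?thesis by simp
qed

lemma monomial_upd: "monomial (\<alpha>(i := a)) x = x $ i ^ a * (\<Prod>j\<in>UNIV - {i}. x $ j ^ \<alpha> j)"
  unfolding monomial_def by (subst prod.remove[of _ i]) (auto intro!: prod.cong)

lemma sum_upd: "sum (\<alpha>(i := a)) UNIV + \<alpha> i = sum \<alpha> UNIV + a" for \<alpha> :: "'n::finite \<Rightarrow> nat"
  using sum.remove[of UNIV i \<alpha>] sum.remove[of UNIV i "\<alpha>(i := a)"] by simp

lemma partial_deriv_monomial:
  "partial_deriv i (monomial \<alpha>) x = of_nat (\<alpha> i) * monomial (\<alpha>(i := \<alpha> i - 1)) x"
proof -
  have "(monomial \<alpha> has_derivative
      (\<lambda>y. \<Sum>j\<in>UNIV. (of_nat (\<alpha> j) * y $ j * x $ j ^ (\<alpha> j - 1)) * (\<Prod>l\<in>UNIV - {j}. x $ l ^ \<alpha> l))) (at x)"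
    unfolding monomial_def[abs_def]
    by (rule has_derivative_prod)
       (auto intro!: derivative_eq_intros bounded_linear_imp_has_derivative bounded_linear_vec_nth)
  then have "partial_deriv i (monomial \<alpha>) x =
      (\<Sum>j\<in>UNIV. (of_nat (\<alpha> j) * axis i 1 $ j * x $ j ^ (\<alpha> j - 1)) * (\<Prod>l\<in>UNIV - {j}. x $ l ^ \<alpha> l))"
    by (rule partial_deriv_eqI)
  also have "\<dots> = (\<Sum>j\<in>UNIV. if j = i then
      of_nat (\<alpha> i) * x $ i ^ (\<alpha> i - 1) * (\<Prod>l\<in>UNIV - {i}. x $ l ^ \<alpha> l) else 0)"
    by (rule sum.cong) (auto simp: axis_def)
  also have "\<dots> = of_nat (\<alpha> i) * monomial (\<alpha>(i := \<alpha> i - 1)) x"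
    by (simp add: monomial_upd)
  finally show ?thesis .
qed

text \<open>An enumeration \<open>e\<close> of the index type turns an exponent function into the
  list of its values, for which stars and bars is \<open>card_length_sum_list\<close>.\<close>

lemma bij_betw_multi_indices_lists:
  "\<exists>F. bij_betw F (multi_indices k :: ('n::finite \<Rightarrow> nat) set)
     {l. size l = CARD('n) \<and> sum_list l = k}"
proof -
  obtain e where e: "bij_betw e {0..<CARD('n)} (UNIV :: 'n set)"
    using ex_bij_betw_nat_finite[of "UNIV :: 'n set"] by auto
  define e' where "e' = the_inv_into {0..<CARD('n)} e"
  have e': "e' i < CARD('n)" "e (e' i) = i" for i
    using e f_the_inv_into_f_bij_betw[OF e] bij_betw_the_inv_into[OF e]
    by (auto simp: e'_def bij_betw_def)
  have e'e: "e' (e j) = j" if "j < CARD('n)" for j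
    unfolding e'_def using the_inv_into_f_f[of e "{0..<CARD('n)}" j] e that by (auto simp: bij_betw_def)
  have sum: "sum_list (map (\<lambda>j. \<alpha> (e j)) [0..<CARD('n)]) = sum \<alpha> UNIV" for \<alpha> :: "'n \<Rightarrow> nat"
    by (simp add: sum_list_distinct_conv_sum_set sum.reindex_bij_betw[OF e])
  have "bij_betw (\<lambda>\<alpha>. map (\<lambda>j. \<alpha> (e j)) [0..<CARD('n)]) (multi_indices k)
      {l. size l = CARD('n) \<and> sum_list l = k}"
  proof (rule bij_betwI[where g = "\<lambda>l i. l ! e' i"])
    show "(\<lambda>l i. l ! e' i) \<in> {l. size l = CARD('n) \<and> sum_list l = k} \<rightarrow> multi_indices k"
    proof
      fix l :: "nat list" assume l: "l \<in> {l. size l = CARD('n) \<and> sum_list l = k}"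
      have "map (\<lambda>j. l ! e' (e j)) [0..<CARD('n)] = l"
        using l by (intro nth_equalityI) (auto simp: e'e)
      then show "(\<lambda>i. l ! e' i) \<in> multi_indices k"
        using sum[of "\<lambda>i. l ! e' i"] l by (simp add: multi_indices_def)
    qed
  qed (auto simp: multi_indices_def sum e' e'e intro!: nth_equalityI)
  then show ?thesis by blast
qed

lemma card_multi_indices:
  "card (multi_indices k :: ('n::finite \<Rightarrow> nat) set) = (k + CARD('n) - 1) choose k"
  using bij_betw_multi_indices_lists[where 'n = 'n, of k] bij_betw_same_card card_length_sum_list
  by metis

lemma finite_multi_indices: "finite (multi_indices k :: ('n::finite \<Rightarrow> nat) set)"
proof (rule finite_subset)
  show "finite (PiE (UNIV :: 'n set) (\<lambda>_. {..k}))" by (rule finite_PiE) auto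
  show "multi_indices k \<subseteq> PiE (UNIV :: 'n set) (\<lambda>_. {..k})"
  proof
    fix \<alpha> :: "'n \<Rightarrow> nat" assume "\<alpha> \<in> multi_indices k"
    then have "\<alpha> i \<le> k" for i by (auto simp: multi_indices_def intro: member_le_sum)
    then show "\<alpha> \<in> PiE UNIV (\<lambda>_. {..k})" by auto
  qed
qed

lemma real_polynomial_function_span_monomials:
  fixes f :: "real ^ 'n \<Rightarrow> real"
  assumes "real_polynomial_function f"
  shows "f \<in> fun_vs.span (range monomial)"
  using assms
proof (induction rule: real_polynomial_function.induct)
  case (linear f)
  have "f = (\<Sum>i\<in>UNIV. fun_scaleR (f (axis i 1)) (monomial (\<lambda>j. if j = i then 1 else 0)))"
  proof
    fix x :: "real ^ 'n"
    interpret f: bounded_linear f by (rule linear)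
    have "f x = f (\<Sum>i\<in>UNIV. x $ i *\<^sub>R axis i 1)"
      using basis_expansion[of x] by (simp add: scalar_mult_eq_scaleR)
    also have "\<dots> = (\<Sum>i\<in>UNIV. fun_scaleR (f (axis i 1)) (monomial (\<lambda>j. if j = i then 1 else 0)) x)"
      by (simp add: f.sum f.scaleR fun_scaleR_def monomial_coordinate mult.commute)
    finally show "f x = (\<Sum>i\<in>UNIV. fun_scaleR (f (axis i 1)) (monomial (\<lambda>j. if j = i then 1 else 0))) x"
      by (simp add: sum_fun_apply)
  qed
  also have "\<dots> \<in> fun_vs.span (range monomial)"
    by (intro fun_vs.span_sum fun_vs.span_scale fun_vs.span_base) auto
  finally show ?case .
next
  case (const c)
  have "(\<lambda>x. c) = fun_scaleR c (monomial (\<lambda>i. 0) :: real ^ 'n \<Rightarrow> real)"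
    by (simp add: fun_eq_iff fun_scaleR_def monomial_zero)
  then show ?case by (simp add: fun_vs.span_scale fun_vs.span_base)
next
  case (add f g)
  then show ?case using fun_vs.span_add[of f _ g] by (simp add: plus_fun_def)
next
  case (mult f g)
  \<comment> \<open>Bilinearity: the product with a fixed monomial is treated first, then the other
    factor varies over the span.\<close>
  have "(\<lambda>x. monomial \<alpha> x * g x) \<in> fun_vs.span (range monomial)" for \<alpha>
    using mult.IH(2)
  proof (induction rule: fun_vs.span_induct_alt)
    case base
    then show ?case using fun_vs.span_zero by (simp add: zero_fun_def)
  next
    case (step c u v)
    then obtain \<beta> where "u = monomial \<beta>" by auto
    then have "(\<lambda>x. monomial \<alpha> x * (fun_scaleR c u + v) x) =
        fun_scaleR c (monomial (\<lambda>i. \<alpha> i + \<beta> i)) + (\<lambda>x. monomial \<alpha> x * v x)"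
      by (simp add: fun_eq_iff fun_scaleR_def monomial_add algebra_simps)
    then show ?case using step(2) by (simp add: fun_vs.span_add fun_vs.span_scale fun_vs.span_base)
  qed
  note * = this
  show ?case using mult.IH(1)
  proof (induction rule: fun_vs.span_induct_alt)
    case base
    then show ?case using fun_vs.span_zero by (simp add: zero_fun_def)
  next
    case (step c u v)
    then obtain \<beta> where "u = monomial \<beta>" by auto
    then have "(\<lambda>x. (fun_scaleR c u + v) x * g x) =
        fun_scaleR c (\<lambda>x. monomial \<beta> x * g x) + (\<lambda>x. v x * g x)"
      by (simp add: fun_eq_iff fun_scaleR_def algebra_simps)
    then show ?case using step(2) * by (simp add: fun_vs.span_add fun_vs.span_scale)
  qed
qed

text \<open>For fixed \<open>x\<close>, the value of \<open>f\<close> at \<open>t\<close> times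
  \<open>x\<close> is a polynomial in \<open>t\<close>. Homogeneity makes it
  \<open>t ^ k * f x\<close>, and uniqueness of coefficients leaves only the monomials of total
  degree \<open>k\<close>.\<close>

lemma homogeneous_polysE:
  fixes f :: "real ^ 'n \<Rightarrow> real"
  assumes "f \<in> homogeneous_polys k"
  obtains c where "f = (\<lambda>x. \<Sum>\<alpha>\<in>multi_indices k. c \<alpha> * monomial \<alpha> x)"
proof -
  have hom: "f (t *\<^sub>R x) = t ^ k * f x" for t x
    using assms by (auto simp: homogeneous_polys_def)
  have "f \<in> fun_vs.span (range monomial)"
    using assms by (auto simp: homogeneous_polys_def real_polynomial_function_span_monomials)
  then obtain T r where T: "finite T" "T \<subseteq> range monomial" "f = (\<Sum>u\<in>T. fun_scaleR (r u) u)"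
    unfolding fun_vs.span_explicit by blast
  obtain A where A: "inj_on monomial A" "T = monomial ` A"
    using T(2) by (metis subset_image_inj)
  have finA: "finite A" using T(1) A by (simp add: finite_image_iff)
  have f: "f x = (\<Sum>\<alpha>\<in>A. r (monomial \<alpha>) * monomial \<alpha> x)" for x
    unfolding T(3) A(2) sum.reindex[OF A(1)] by (simp add: sum_fun_apply fun_scaleR_def)
  \<comment> \<open>\<open>k\<close> is inserted so that the coefficient to be compared lies in the
    range even if no monomial in \<open>A\<close> has degree \<open>k\<close> or more.\<close>
  define n where "n = Max (insert k ((\<lambda>\<alpha>. sum \<alpha> UNIV) ` A))"
  have n: "k \<le> n" "\<And>\<alpha>. \<alpha> \<in> A \<Longrightarrow> sum \<alpha> UNIV \<le> n"
    using finA by (auto simp: n_def)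
  have fx: "f x = (\<Sum>\<alpha>\<in>{\<alpha> \<in> A. sum \<alpha> UNIV = k}. r (monomial \<alpha>) * monomial \<alpha> x)" for x
  proof -
    define a where "a d = (\<Sum>\<alpha>\<in>{\<alpha> \<in> A. sum \<alpha> UNIV = d}. r (monomial \<alpha>) * monomial \<alpha> x)" for d
    define b where "b d = (if d = k then f x else 0)" for d
    have "(\<Sum>d\<le>n. a d * t ^ d) = (\<Sum>d\<le>n. b d * t ^ d)" for t
    proof -
      have "(\<Sum>d\<le>n. a d * t ^ d) =
          (\<Sum>d\<le>n. \<Sum>\<alpha>\<in>{\<alpha> \<in> A. sum \<alpha> UNIV = d}. r (monomial \<alpha>) * monomial \<alpha> (t *\<^sub>R x))"
        unfolding a_def sum_distrib_right
        by (intro sum.cong refl) (auto simp: monomial_scaleR)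
      also have "\<dots> = f (t *\<^sub>R x)"
        unfolding f using finA n(2) by (intro sum.group) auto
      also have "\<dots> = (\<Sum>d\<le>n. b d * t ^ d)"
        using n(1) by (simp add: hom b_def if_distrib if_distribR cong: if_cong)
      finally show ?thesis .
    qed
    then have "a k = b k" using polyfun_eq_coeffs[of a n b] n(1) by blast
    then show ?thesis by (simp add: a_def b_def)
  qed
  have "f x = (\<Sum>\<alpha>\<in>multi_indices k. (if \<alpha> \<in> A then r (monomial \<alpha>) else 0) * monomial \<alpha> x)" for x
    unfolding fx by (rule sum.mono_neutral_cong_left[OF finite_multi_indices])
      (auto simp: multi_indices_def)
  then show ?thesis using that[of "\<lambda>\<alpha>. if \<alpha> \<in> A then r (monomial \<alpha>) else 0"] by blast
qed

lemma monomial_in_homogeneous_polys: "\<alpha> \<in> multi_indices k \<Longrightarrow> monomial \<alpha> \<in> homogeneous_polys k"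
  by (simp add: homogeneous_polys_def real_polynomial_function_monomial monomial_scaleR multi_indices_def)

subsection \<open>Homogeneous polynomials\<close>

lemma homogeneous_polys_poly: "f \<in> homogeneous_polys k \<Longrightarrow> real_polynomial_function f"
  by (simp add: homogeneous_polys_def)

lemma homogeneous_polys_0: "(\<lambda>x. 0) \<in> homogeneous_polys k"
  by (simp add: homogeneous_polys_def real_polynomial_function.intros)

lemma homogeneous_polys_add:
  "f \<in> homogeneous_polys k \<Longrightarrow> g \<in> homogeneous_polys k \<Longrightarrow> (\<lambda>x. f x + g x) \<in> homogeneous_polys k"
  by (auto simp: homogeneous_polys_def algebra_simps)

lemma homogeneous_polys_cmult:
  "f \<in> homogeneous_polys k \<Longrightarrow> (\<lambda>x. c * f x) \<in> homogeneous_polys k"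
  by (auto simp: homogeneous_polys_def)

lemma homogeneous_polys_sum:
  "(\<And>a. a \<in> A \<Longrightarrow> f a \<in> homogeneous_polys k) \<Longrightarrow> (\<lambda>x. \<Sum>a\<in>A. f a x) \<in> homogeneous_polys k"
  by (induction A rule: infinite_finite_induct) (auto simp: homogeneous_polys_0 homogeneous_polys_add)

lemma homogeneous_polys_coordinate_mult:
  "f \<in> homogeneous_polys k \<Longrightarrow> (\<lambda>x. x $ i * f x) \<in> homogeneous_polys (Suc k)"
  by (auto simp: homogeneous_polys_def intro!: real_polynomial_function.intros(4) real_polynomial_function_coordinate)

lemma partial_deriv_sum_poly:
  assumes "\<And>a. a \<in> A \<Longrightarrow> real_polynomial_function (f a)"
  shows "partial_deriv i (\<lambda>x. \<Sum>a\<in>A. c a * f a x) = (\<lambda>x. \<Sum>a\<in>A. c a * partial_deriv i (f a) x)"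
proof
  fix x
  have d: "f a differentiable at x" if "a \<in> A" for a
    using assms[OF that] by (rule differentiable_at_real_polynomial_function)
  show "partial_deriv i (\<lambda>x. \<Sum>a\<in>A. c a * f a x) x = (\<Sum>a\<in>A. c a * partial_deriv i (f a) x)"
    using d partial_deriv_bounded_linear[OF bounded_linear_mult_right d]
    by (subst partial_deriv_sum) (auto intro!: differentiable_mult)
qed

text \<open>In degree 0 the subtraction \<open>k - 1\<close> truncates to 0; the second claim covers
  this case, in which the derivative vanishes.\<close>

lemma partial_deriv_homogeneous:
  assumes "f \<in> homogeneous_polys k"
  shows "partial_deriv i f \<in> homogeneous_polys (k - 1)"
    and "k = 0 \<Longrightarrow> partial_deriv i f x = 0"
proof -
  obtain c where f: "f = (\<lambda>x. \<Sum>\<alpha>\<in>multi_indices k. c \<alpha> * monomial \<alpha> x)"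
    using homogeneous_polysE[OF assms] .
  have *: "partial_deriv i f = (\<lambda>x. \<Sum>\<alpha>\<in>multi_indices k. c \<alpha> * partial_deriv i (monomial \<alpha>) x)"
    unfolding f by (rule partial_deriv_sum_poly) (rule real_polynomial_function_monomial)
  have "(\<lambda>x. of_nat (\<alpha> i) * monomial (\<alpha>(i := \<alpha> i - 1)) x) \<in> homogeneous_polys (k - 1)"
    if "\<alpha> \<in> multi_indices k" for \<alpha>
  \<comment> \<open>If \<open>\<alpha> i = 0\<close>, the truncated exponent still has degree
    \<open>k\<close>, but its factor is 0.\<close>
  proof (cases "\<alpha> i = 0")
    case False
    then have "\<alpha>(i := \<alpha> i - 1) \<in> multi_indices (k - 1)"
      using that sum_upd[of \<alpha> i "\<alpha> i - 1"] by (auto simp: multi_indices_def simp del: fun_upd_apply)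
    then show ?thesis by (intro homogeneous_polys_cmult monomial_in_homogeneous_polys)
  qed (simp add: homogeneous_polys_0)
  then show "partial_deriv i f \<in> homogeneous_polys (k - 1)"
    unfolding * partial_deriv_monomial
    by (intro homogeneous_polys_sum homogeneous_polys_cmult[where f = "\<lambda>x. of_nat _ * _ x"])
  show "partial_deriv i f x = 0" if "k = 0"
  proof -
    have "\<alpha> i = 0" if "\<alpha> \<in> multi_indices k" for \<alpha>
      using that \<open>k = 0\<close> by (auto simp: multi_indices_def)
    then show ?thesis unfolding * partial_deriv_monomial by (intro sum.neutral) auto
  qed
qed

text \<open>On a monomial, \<open>x $ i\<close> times the \<open>i\<close>-th derivative multiplies
  by the exponent of \<open>x $ i\<close>, and the exponents add up to \<open>k\<close>.\<close>

lemma euler_homogeneous: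
  assumes "f \<in> homogeneous_polys k"
  shows "(\<Sum>i\<in>UNIV. x $ i * partial_deriv i f x) = of_nat k * f x"
proof -
  obtain c where f: "f = (\<lambda>x. \<Sum>\<alpha>\<in>multi_indices k. c \<alpha> * monomial \<alpha> x)"
    using homogeneous_polysE[OF assms] .
  have "monomial \<alpha> x = x $ i ^ \<alpha> i * (\<Prod>j\<in>UNIV - {i}. x $ j ^ \<alpha> j)" for i \<alpha>
    using monomial_upd[of \<alpha> i "\<alpha> i" x] by simp
  note split = this
  have mono: "x $ i * partial_deriv i (monomial \<alpha>) x = of_nat (\<alpha> i) * monomial \<alpha> x" for i \<alpha>
  proof (cases "\<alpha> i")
    case (Suc n)
    then show ?thesis
      using split[of \<alpha> i] by (simp add: partial_deriv_monomial monomial_upd algebra_simps)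
  qed (simp add: partial_deriv_monomial)
  have "(\<Sum>i\<in>UNIV. x $ i * partial_deriv i f x) =
      (\<Sum>i\<in>UNIV. \<Sum>\<alpha>\<in>multi_indices k. c \<alpha> * (x $ i * partial_deriv i (monomial \<alpha>) x))"
    unfolding f
    by (simp add: partial_deriv_sum_poly real_polynomial_function_monomial sum_distrib_left algebra_simps)
  also have "\<dots> = (\<Sum>\<alpha>\<in>multi_indices k. \<Sum>i\<in>UNIV. c \<alpha> * (of_nat (\<alpha> i) * monomial \<alpha> x))"
    unfolding mono by (rule sum.swap)
  also have "\<dots> = (\<Sum>\<alpha>\<in>multi_indices k. c \<alpha> * (of_nat k * monomial \<alpha> x))"
    by (intro sum.cong refl)
       (auto simp: multi_indices_def sum_distrib_left[symmetric] sum_distrib_right[symmetric]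
         of_nat_sum[symmetric] simp del: of_nat_sum)
  also have "\<dots> = of_nat k * f x"
    by (simp add: f sum_distrib_left algebra_simps)
  finally show ?thesis .
qed

text \<open>Differentiating a relation in a variable that occurs in \<open>\<alpha>\<close> gives a
  relation of degree one less: the monomials without this variable disappear and the others stay
  distinct.\<close>

lemma monomials_independent:
  fixes c :: "('n::finite \<Rightarrow> nat) \<Rightarrow> real"
  assumes "\<And>x. (\<Sum>\<alpha>\<in>multi_indices k. c \<alpha> * monomial \<alpha> x) = 0" "\<alpha> \<in> multi_indices k"
  shows "c \<alpha> = 0"
  using assms
proof (induction k arbitrary: c \<alpha>)
  case 0
  have "multi_indices 0 = {\<lambda>i::'n. 0}" by (auto simp: multi_indices_def)
  then show ?case using 0 by (simp add: monomial_zero)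
next
  case (Suc k)
  obtain i where i: "\<alpha> i > 0"
    using Suc.prems(2) by (force simp: multi_indices_def)
  define inc where "inc \<beta> = \<beta>(i := Suc (\<beta> i))" for \<beta> :: "'n \<Rightarrow> nat"
  have "(\<Sum>\<beta>\<in>multi_indices k. (c (inc \<beta>) * of_nat (Suc (\<beta> i))) * monomial \<beta> x) = 0" for x
  proof -
    have "0 = partial_deriv i (\<lambda>x. \<Sum>\<alpha>\<in>multi_indices (Suc k). c \<alpha> * monomial \<alpha> x) x"
      by (simp add: Suc.prems(1) partial_deriv_const)
    also have "\<dots> = (\<Sum>\<alpha>\<in>multi_indices (Suc k). c \<alpha> * (of_nat (\<alpha> i) * monomial (\<alpha>(i := \<alpha> i - 1)) x))"
      by (simp add: partial_deriv_sum_poly real_polynomial_function_monomial partial_deriv_monomial)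
    also have "\<dots> = (\<Sum>\<alpha>\<in>{\<alpha> \<in> multi_indices (Suc k). \<alpha> i > 0}.
        c \<alpha> * (of_nat (\<alpha> i) * monomial (\<alpha>(i := \<alpha> i - 1)) x))"
      by (rule sum.mono_neutral_right) (auto simp: finite_multi_indices)
    also have "\<dots> = (\<Sum>\<beta>\<in>multi_indices k. (c (inc \<beta>) * of_nat (Suc (\<beta> i))) * monomial \<beta> x)"
    proof (rule sum.reindex_bij_witness[where i = inc and j = "\<lambda>\<alpha>. \<alpha>(i := \<alpha> i - 1)"])
      fix \<beta> :: "'n \<Rightarrow> nat" assume "\<beta> \<in> multi_indices k"
      then show "inc \<beta> \<in> {\<alpha> \<in> multi_indices (Suc k). \<alpha> i > 0}"
        using sum_upd[of \<beta> i "Suc (\<beta> i)"] by (auto simp: multi_indices_def inc_def)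
    next
      fix \<beta> :: "'n \<Rightarrow> nat" assume "\<beta> \<in> {\<alpha> \<in> multi_indices (Suc k). \<alpha> i > 0}"
      then show "\<beta>(i := \<beta> i - 1) \<in> multi_indices k"
        using sum_upd[of \<beta> i "\<beta> i - 1"] by (auto simp: multi_indices_def)
    qed (auto simp: inc_def fun_eq_iff)
    finally show ?thesis by simp
  qed
  moreover have "\<alpha>(i := \<alpha> i - 1) \<in> multi_indices k"
    using Suc.prems(2) i sum_upd[of \<alpha> i "\<alpha> i - 1"] by (auto simp: multi_indices_def)
  ultimately have "c (inc (\<alpha>(i := \<alpha> i - 1))) * of_nat (Suc ((\<alpha>(i := \<alpha> i - 1)) i)) = 0"
    by (rule Suc.IH)
  moreover have "inc (\<alpha>(i := \<alpha> i - 1)) = \<alpha>" using i by (auto simp: inc_def fun_eq_iff)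
  ultimately show ?case by simp
qed

section \<open>Surjectivity of the Laplacian on homogeneous polynomials\<close>

definition laplacian :: "(real ^ 'n \<Rightarrow> real) \<Rightarrow> real ^ 'n \<Rightarrow> real" where
  "laplacian f x = (\<Sum>i\<in>UNIV. partial_deriv i (partial_deriv i f) x)"

lemma laplacian_sum:
  assumes "\<And>a. a \<in> A \<Longrightarrow> real_polynomial_function (f a)"
  shows "laplacian (\<lambda>x. \<Sum>a\<in>A. c a * f a x) x = (\<Sum>a\<in>A. c a * laplacian (f a) x)"
proof -
  have "laplacian (\<lambda>x. \<Sum>a\<in>A. c a * f a x) x =
      (\<Sum>i\<in>UNIV. \<Sum>a\<in>A. c a * partial_deriv i (partial_deriv i (f a)) x)"
    using assms by (simp add: laplacian_def partial_deriv_sum_poly real_polynomial_function_partial_deriv)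
  also have "\<dots> = (\<Sum>a\<in>A. c a * laplacian (f a) x)"
    by (subst sum.swap) (simp add: laplacian_def sum_distrib_left)
  finally show ?thesis .
qed

lemma laplacian_monomial:
  "laplacian (monomial \<alpha>) x =
    (\<Sum>i\<in>UNIV. of_nat (\<alpha> i * (\<alpha> i - 1)) * monomial (\<alpha>(i := \<alpha> i - 2)) x)"
proof -
  \<comment> \<open>The sum over the one-element set \<open>{()}\<close> lets
    \<open>partial_deriv_sum_poly\<close> handle a scalar multiple.\<close>
  have "partial_deriv i (monomial \<alpha>) = (\<lambda>x. \<Sum>u\<in>{()}. of_nat (\<alpha> i) * monomial (\<alpha>(i := \<alpha> i - 1)) x)" for i
    by (simp add: fun_eq_iff partial_deriv_monomial)
  then show ?thesis
    unfolding laplacian_def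
    by (simp only: partial_deriv_sum_poly real_polynomial_function_monomial)
       (simp add: partial_deriv_monomial numeral_2_eq_2 mult.assoc)
qed

(* Induction on the degree in the variables other than a fixed x_a: up to a factor, the Laplacian of
   x_a^2 x^alpha is x^alpha plus terms of higher degree in x_a. *)
lemma laplacian_onto_monomial:
  fixes \<alpha> :: "'n::finite \<Rightarrow> nat"
  assumes "\<alpha> \<in> multi_indices k"
  shows "\<exists>g \<in> homogeneous_polys (k + 2). \<forall>x. laplacian g x = monomial \<alpha> x"
proof -
  obtain a :: 'n where True by simp
  show ?thesis
    using assms
  proof (induction "k - \<alpha> a" arbitrary: \<alpha> rule: less_induct)
    case less
    define \<beta> where "\<beta> = \<alpha>(a := \<alpha> a + 2)"
    have \<beta>: "\<beta> \<in> multi_indices (k + 2)"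
      using less.prems sum_upd[of \<alpha> a "\<alpha> a + 2"] by (simp add: multi_indices_def \<beta>_def)
    \<comment> \<open>Each term of the Laplacian of \<open>monomial \<beta>\<close> in a direction
      other than \<open>a\<close> is itself a Laplacian: either its coefficient is 0, or its
      exponent at \<open>a\<close> exceeds \<open>\<alpha> a\<close> by 2 and the induction
      hypothesis applies.\<close>
    have "\<exists>g \<in> homogeneous_polys (k + 2). \<forall>x. laplacian g x =
        of_nat (\<beta> i * (\<beta> i - 1)) * monomial (\<beta>(i := \<beta> i - 2)) x" if "i \<noteq> a" for i
    proof (cases "\<beta> i \<ge> 2")
      case True
      define \<gamma> where "\<gamma> = \<beta>(i := \<beta> i - 2)"
      have \<gamma>: "\<gamma> \<in> multi_indices k"
        using \<beta> True sum_upd[of \<beta> i "\<beta> i - 2"] by (simp add: multi_indices_def \<gamma>_def)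
      have "\<gamma> a = \<alpha> a + 2" using that by (simp add: \<gamma>_def \<beta>_def)
      moreover have "\<gamma> a \<le> k" using \<gamma> by (auto simp: multi_indices_def intro: member_le_sum)
      ultimately have "k - \<gamma> a < k - \<alpha> a" by simp
      from less.hyps[OF this \<gamma>] obtain g where
        g: "g \<in> homogeneous_polys (k + 2)" "\<And>x. laplacian g x = monomial \<gamma> x" by auto
      let ?c = "of_nat (\<beta> i * (\<beta> i - 1)) :: real"
      have "laplacian (\<lambda>x. \<Sum>u\<in>{()}. ?c * g x) x = (\<Sum>u\<in>{()}. ?c * laplacian g x)" for x
        by (rule laplacian_sum) (rule homogeneous_polys_poly[OF g(1)])
      then show ?thesis
        using g homogeneous_polys_cmult[OF g(1), of ?c]
        by (intro bexI[of _ "\<lambda>x. ?c * g x"]) (auto simp: \<gamma>_def)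
    next
      case False
      then have "\<beta> i = 0 \<or> \<beta> i = 1" by auto
      then have "\<beta> i * (\<beta> i - 1) = 0" by auto
      moreover have "laplacian (\<lambda>x. 0) x = 0" for x :: "real ^ 'n"
        by (simp add: laplacian_def partial_deriv_const[abs_def])
      ultimately show ?thesis using homogeneous_polys_0 by (intro bexI[of _ "\<lambda>x. 0"]) auto
    qed
    then obtain h where h: "\<And>i. i \<noteq> a \<Longrightarrow> h i \<in> homogeneous_polys (k + 2)"
      "\<And>i x. i \<noteq> a \<Longrightarrow> laplacian (h i) x = of_nat (\<beta> i * (\<beta> i - 1)) * monomial (\<beta>(i := \<beta> i - 2)) x"
      by metis
    define f where "f i = (if i = a then monomial \<beta> else h i)" for i
    \<comment> \<open>\<open>C\<close> is the coefficient of \<open>monomial \<alpha>\<close> in the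
      Laplacian of \<open>monomial \<beta>\<close>; the preimage is \<open>monomial \<beta>\<close>
      minus the corrections \<open>h i\<close>, divided by \<open>C\<close>.\<close>
    define C where "C = real ((\<alpha> a + 2) * (\<alpha> a + 1))"
    define c where "c i = (if i = a then 1 / C else - (1 / C))" for i
    have f: "f i \<in> homogeneous_polys (k + 2)" for i
      using h(1) monomial_in_homogeneous_polys[OF \<beta>] by (auto simp: f_def)
    define g where "g = (\<lambda>x. \<Sum>i\<in>UNIV. c i * f i x)"
    have "g \<in> homogeneous_polys (k + 2)"
      unfolding g_def by (intro homogeneous_polys_sum homogeneous_polys_cmult f)
    moreover have "laplacian g x = monomial \<alpha> x" for x
    proof -
      let ?S = "\<Sum>i\<in>UNIV - {a}. of_nat (\<beta> i * (\<beta> i - 1)) * monomial (\<beta>(i := \<beta> i - 2)) x"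
      have "laplacian g x = (\<Sum>i\<in>UNIV. c i * laplacian (f i) x)"
        unfolding g_def by (rule laplacian_sum) (rule homogeneous_polys_poly[OF f])
      also have "\<dots> = c a * laplacian (f a) x + (\<Sum>i\<in>UNIV - {a}. c i * laplacian (f i) x)"
        by (rule sum.remove) auto
      also have "(\<Sum>i\<in>UNIV - {a}. c i * laplacian (f i) x) =
          - (1 / C) * ?S"
        unfolding sum_distrib_left by (rule sum.cong) (auto simp: c_def f_def h(2))
      also have "laplacian (f a) x = of_nat (\<beta> a * (\<beta> a - 1)) * monomial (\<beta>(a := \<beta> a - 2)) x + ?S"
        by (simp add: f_def laplacian_monomial sum.remove[of UNIV a])
      also have "of_nat (\<beta> a * (\<beta> a - 1)) = C" by (simp add: \<beta>_def C_def)
      also have "\<beta>(a := \<beta> a - 2) = \<alpha>" by (simp add: \<beta>_def)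
      finally have *: "laplacian g x = c a * (C * monomial \<alpha> x + ?S) + - (1 / C) * ?S" .
      have "C \<noteq> 0" unfolding C_def of_nat_eq_0_iff by simp
      then show ?thesis unfolding * by (simp add: c_def algebra_simps)
    qed
    ultimately show ?case by blast
  qed
qed

lemma laplacian_onto:
  fixes f :: "real ^ 'n \<Rightarrow> real"
  assumes "f \<in> homogeneous_polys k"
  shows "\<exists>g \<in> homogeneous_polys (k + 2). \<forall>x. laplacian g x = f x"
proof -
  obtain c where f: "f = (\<lambda>x. \<Sum>\<alpha>\<in>multi_indices k. c \<alpha> * monomial \<alpha> x)"
    using homogeneous_polysE[OF assms] .
  have "\<forall>\<alpha>\<in>multi_indices k. \<exists>g. g \<in> homogeneous_polys (k + 2) \<and> (\<forall>x::real^'n. laplacian g x = monomial \<alpha> x)"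
    using laplacian_onto_monomial by blast
  from bchoice[OF this] obtain h :: "('n \<Rightarrow> nat) \<Rightarrow> real ^ 'n \<Rightarrow> real" where h: "\<And>\<alpha>. \<alpha> \<in> multi_indices k \<Longrightarrow> h \<alpha> \<in> homogeneous_polys (k + 2)"
    "\<And>\<alpha> x. \<alpha> \<in> multi_indices k \<Longrightarrow> laplacian (h \<alpha>) x = monomial \<alpha> x"
    by blast
  show ?thesis
  proof
    show "(\<lambda>x. \<Sum>\<alpha>\<in>multi_indices k. c \<alpha> * h \<alpha> x) \<in> homogeneous_polys (k + 2)"
      by (intro homogeneous_polys_sum homogeneous_polys_cmult h)
    show "\<forall>x. laplacian (\<lambda>x. \<Sum>\<alpha>\<in>multi_indices k. c \<alpha> * h \<alpha> x) x = f x"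
      using h(2) homogeneous_polys_poly[OF h(1)] by (subst laplacian_sum) (auto simp: f)
  qed
qed

subsection \<open>Exterior algebra\<close>

lemma sgn_pos_square: "sgn_pos i I * sgn_pos i I = 1"
  by (simp add: sgn_pos_def flip: power_mult_distrib)

lemma sgn_pos_insert_other:
  "j \<notin> I \<Longrightarrow> sgn_pos i (insert j I) = (if j < i then - sgn_pos i I else sgn_pos i I)"
proof -
  assume j: "j \<notin> I"
  have "{l \<in> insert j I. l < i} = (if j < i then insert j {l \<in> I. l < i} else {l \<in> I. l < i})"
    by auto
  then show ?thesis using j by (simp add: sgn_pos_def)
qed

lemma sgn_pos_remove:
  "j \<in> I \<Longrightarrow> sgn_pos i (I - {j}) = (if j < i then - sgn_pos i I else sgn_pos i I)"
  using sgn_pos_insert_other[of j "I - {j}" i] by (auto simp: insert_absorb)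

text \<open>The anticommutation relations behind both Cartan's formula and the Hodge Laplacian. For
  distinct \<open>i\<close> and \<open>j\<close> the two orders read the same coefficient of
  \<open>v\<close> with opposite signs: if \<open>i < j\<close>, removing \<open>i\<close> flips the
  sign of \<open>j\<close>, and otherwise inserting \<open>j\<close> flips the sign of
  \<open>i\<close>.\<close>

lemma wedge_dx_contract:
  "wedge_dx i (contract j v) + contract j (wedge_dx i v) = (if i = j then v else 0)"
proof -
  have "(wedge_dx i (contract j v) + contract j (wedge_dx i v)) $ I = (if i = j then v $ I else 0)" for I
  proof (cases "i = j")
    case True
    have "sgn_pos j I * (sgn_pos j I * v $ I) = v $ I" by (simp add: sgn_pos_square flip: mult.assoc)
    then show ?thesis using True
      by (cases "j \<in> I") (simp_all add: wedge_dx_def contract_def sgn_pos_remove sgn_pos_insert_other insert_absorb)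
  next
    case False
    show ?thesis
    proof (cases "i \<in> I \<and> j \<notin> I")
      case True
      then have "insert j (I - {i}) = insert j I - {i}" using False by auto
      moreover have "i < j \<longleftrightarrow> \<not> j < i" using False by auto
      ultimately show ?thesis using True False
        by (simp add: wedge_dx_def contract_def sgn_pos_remove sgn_pos_insert_other)
    next
      case c: False
      then show ?thesis using False by (cases "i \<in> I") (simp_all add: wedge_dx_def contract_def)
    qed
  qed
  then show ?thesis by (simp add: vec_eq_iff)
qed

lemma contract_contract: "contract i (contract j v) = - contract j (contract i v)"
proof -
  have "contract i (contract j v) $ I = - contract j (contract i v) $ I" for I
  proof (cases "i = j \<or> i \<in> I \<or> j \<in> I")
    case True
    then show ?thesis by (auto simp: contract_def)
  next
    case False
    then have "i < j \<longleftrightarrow> \<not> j < i" "j \<noteq> i" by auto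
    then show ?thesis using False
      by (simp add: contract_def sgn_pos_insert_other insert_commute[of i j])
  qed
  then show ?thesis by (simp add: vec_eq_iff)
qed

text \<open>\<open>wedge_dx i\<close> after \<open>contract i\<close> is the projection to the
  monomials that contain dx_i, so the sum counts the form degree. This is the source of the summand
  \<open>s\<close> in Cartan's factor \<open>k + s\<close>.\<close>

lemma sum_wedge_dx_contract_component:
  "(\<Sum>i\<in>UNIV. wedge_dx i (contract i v)) $ I = of_nat (card I) * v $ I"
proof -
  have "(\<Sum>i\<in>UNIV. wedge_dx i (contract i v)) $ I = (\<Sum>i\<in>UNIV. if i \<in> I then v $ I else 0)"
    unfolding sum_component
    by (rule sum.cong) (auto simp: wedge_dx_def contract_def sgn_pos_remove insert_absorb
        sgn_pos_square mult.assoc[symmetric])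
  also have "\<dots> = of_nat (card I) * v $ I" by (simp add: sum.If_cases)
  finally show ?thesis .
qed

(* The Hodge star up to sign: with these signs it intertwines wedge_dx and contract exactly. *)
definition star_sign :: "'n::{finite,linorder} set \<Rightarrow> real" where
  "star_sign I = (\<Prod>i\<in>I. sgn_pos i UNIV)"

definition star :: "'n::{finite,linorder} exterior \<Rightarrow> 'n exterior" where
  "star v = (\<chi> I. star_sign I * v $ (- I))"

lemma star_sign_insert: "i \<notin> I \<Longrightarrow> star_sign (insert i I) = sgn_pos i UNIV * star_sign I"
  by (simp add: star_sign_def)

lemma star_sign_nonzero: "star_sign I \<noteq> 0"
  by (simp add: star_sign_def sgn_pos_def)

text \<open>The elements below \<open>i\<close> are shared between \<open>I\<close> and its
  complement. Hence the sign by which \<open>star\<close> has to change when \<open>i\<close> joins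
  \<open>I\<close> is \<open>sgn_pos i UNIV\<close>, independent of \<open>I\<close>, and
  \<open>star_sign\<close> can be a product.\<close>

lemma sgn_pos_compl: "sgn_pos i I * sgn_pos i (- I) = sgn_pos i UNIV"
proof -
  have "card {j \<in> UNIV. j < i} = card ({j \<in> I. j < i} \<union> {j \<in> - I. j < i})"
    by (rule arg_cong[where f = card]) auto
  also have "\<dots> = card {j \<in> I. j < i} + card {j \<in> - I. j < i}"
    by (rule card_Un_disjoint) auto
  finally show ?thesis by (simp add: sgn_pos_def power_add)
qed

lemma linear_star: "linear star"
  by (intro linearI) (auto simp: star_def vec_eq_iff algebra_simps)

lemma inj_star: "star v = star w \<longleftrightarrow> v = w"
proof
  assume eq: "star v = star w"
  have "v $ I = w $ I" for I
    using arg_cong[OF eq, of "\<lambda>u. u $ (- I)"] star_sign_nonzero[of "- I"] by (simp add: star_def)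
  then show "v = w" by (simp add: vec_eq_iff)
qed simp

lemma star_eq_0_iff: "star v = 0 \<longleftrightarrow> v = 0"
  by (metis inj_star linear_0 linear_star)

lemma star_contract: "star (contract i v) = wedge_dx i (star v)"
proof -
  have "star (contract i v) $ I = wedge_dx i (star v) $ I" for I
  proof (cases "i \<in> I")
    case True
    have "star_sign I * sgn_pos i (- I) = sgn_pos i UNIV * sgn_pos i (- I) * star_sign (I - {i})"
      using star_sign_insert[of i "I - {i}"] True by (simp add: insert_absorb)
    also have "\<dots> = sgn_pos i I * (sgn_pos i (- I) * sgn_pos i (- I)) * star_sign (I - {i})"
      by (simp add: sgn_pos_compl[of i I, symmetric])
    finally have "star_sign I * sgn_pos i (- I) = sgn_pos i I * star_sign (I - {i})"
      by (simp add: sgn_pos_square)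
    moreover have "- (I - {i}) = insert i (- I)" by auto
    ultimately show ?thesis using True by (simp add: star_def contract_def wedge_dx_def flip: mult.assoc)
  qed (simp add: star_def contract_def wedge_dx_def)
  then show ?thesis by (simp add: vec_eq_iff)
qed

lemma star_wedge_dx: "star (wedge_dx i v) = contract i (star v)"
proof -
  have "star (wedge_dx i v) $ I = contract i (star v) $ I" for I
  proof (cases "i \<in> I")
    case False
    have "sgn_pos i I * star_sign (insert i I) = sgn_pos i I * sgn_pos i UNIV * star_sign I"
      using star_sign_insert[of i I] False by simp
    also have "\<dots> = (sgn_pos i I * sgn_pos i I) * sgn_pos i (- I) * star_sign I"
      by (simp add: sgn_pos_compl[of i I, symmetric])
    finally have "sgn_pos i I * star_sign (insert i I) = sgn_pos i (- I) * star_sign I"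
      by (simp add: sgn_pos_square)
    moreover have "- (insert i I) = - I - {i}" by auto
    ultimately show ?thesis using False by (simp add: star_def contract_def wedge_dx_def flip: mult.assoc)
  qed (simp add: star_def contract_def wedge_dx_def)
  then show ?thesis by (simp add: vec_eq_iff)
qed

lemma wedge_dx_wedge_dx: "wedge_dx i (wedge_dx j v) = - wedge_dx j (wedge_dx i v)"
proof -
  have "star (wedge_dx i (wedge_dx j v)) = - star (wedge_dx j (wedge_dx i v))"
    unfolding star_wedge_dx by (rule contract_contract)
  then show ?thesis by (simp add: inj_star flip: linear_neg[OF linear_star])
qed

lemma bounded_linear_wedge_dx: "bounded_linear (wedge_dx i)"
  using linear_wedge_dx linear_conv_bounded_linear by blast

lemma bounded_linear_contract: "bounded_linear (contract i)"
  using linear_contract linear_conv_bounded_linear by blast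

lemma bounded_linear_star: "bounded_linear star"
  using linear_star linear_conv_bounded_linear by blast

subsection \<open>Differential forms with polynomial coefficients\<close>

lemma polynomial_function_vec:
  fixes \<omega> :: "real ^ 'n \<Rightarrow> real ^ 'b"
  shows "polynomial_function \<omega> \<longleftrightarrow> (\<forall>I. real_polynomial_function (\<lambda>x. \<omega> x $ I))"
  unfolding polynomial_function_iff_Basis_inner Basis_vec_def by (simp add: inner_axis)

lemma polynomial_function_bounded_linear_comp:
  "bounded_linear L \<Longrightarrow> polynomial_function \<omega> \<Longrightarrow> polynomial_function (\<lambda>x. L (\<omega> x))"
  using polynomial_function_compose[OF _ polynomial_function_bounded_linear, of \<omega> L] by (simp add: o_def)

lemma partial_deriv_component:
  fixes \<omega> :: "real ^ 'n \<Rightarrow> real ^ 'b"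
  assumes "polynomial_function \<omega>"
  shows "partial_deriv i \<omega> x $ I = partial_deriv i (\<lambda>x. \<omega> x $ I) x"
  using partial_deriv_bounded_linear[OF bounded_linear_vec_nth differentiable_at_polynomial_function[OF assms]]
  by simp

lemma polynomial_function_partial_deriv:
  fixes \<omega> :: "real ^ 'n \<Rightarrow> real ^ 'b"
  assumes "polynomial_function \<omega>"
  shows "polynomial_function (partial_deriv i \<omega>)"
  using assms real_polynomial_function_partial_deriv
  unfolding polynomial_function_vec partial_deriv_component[OF assms] by blast

lemma partial_deriv_bounded_linear_poly:
  fixes \<omega> :: "real ^ 'n \<Rightarrow> real ^ 'b"
  assumes "bounded_linear L" "polynomial_function \<omega>"
  shows "partial_deriv i (\<lambda>x. L (\<omega> x)) = (\<lambda>x. L (partial_deriv i \<omega> x))"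
  using assms by (intro ext partial_deriv_bounded_linear differentiable_at_polynomial_function)

lemma partial_deriv_sum_poly_vec:
  fixes \<omega> :: "'a \<Rightarrow> real ^ 'n \<Rightarrow> real ^ 'b"
  assumes "\<And>a. a \<in> A \<Longrightarrow> polynomial_function (\<omega> a)"
  shows "partial_deriv i (\<lambda>x. \<Sum>a\<in>A. \<omega> a x) = (\<lambda>x. \<Sum>a\<in>A. partial_deriv i (\<omega> a) x)"
  using assms by (intro ext partial_deriv_sum differentiable_at_polynomial_function)

lemma partial_deriv_commute:
  fixes \<omega> :: "real ^ 'n \<Rightarrow> real ^ 'b"
  assumes "polynomial_function \<omega>"
  shows "partial_deriv i (partial_deriv j \<omega>) x = partial_deriv j (partial_deriv i \<omega>) x"
proof -
  have "partial_deriv i (partial_deriv j \<omega>) x $ I = partial_deriv j (partial_deriv i \<omega>) x $ I" for I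
    using assms partial_deriv_commute_poly[of "\<lambda>x. \<omega> x $ I" i j]
    by (simp add: partial_deriv_component polynomial_function_partial_deriv polynomial_function_vec[of \<omega>])
  then show ?thesis by (simp add: vec_eq_iff)
qed

section \<open>Operators of the Euler field and their relations with \<open>ext_deriv\<close> and
  \<open>codiff\<close>\<close>

definition contract_x :: "'n::{finite,linorder} form \<Rightarrow> 'n form" where
  "contract_x \<omega> = (\<lambda>x. \<Sum>i\<in>UNIV. x $ i *\<^sub>R contract i (\<omega> x))"

definition wedge_x :: "'n::{finite,linorder} form \<Rightarrow> 'n form" where
  "wedge_x \<omega> = (\<lambda>x. \<Sum>i\<in>UNIV. x $ i *\<^sub>R wedge_dx i (\<omega> x))"

definition star_form :: "'n::{finite,linorder} form \<Rightarrow> 'n form" where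
  "star_form \<omega> = (\<lambda>x. star (\<omega> x))"

lemmas linear_sums = linear_sum[OF linear_wedge_dx] linear_sum[OF linear_contract] linear_sum[OF linear_star]
lemmas linear_scales = linear_scale[OF linear_wedge_dx] linear_scale[OF linear_contract] linear_scale[OF linear_star]
lemmas linear_adds = linear_add[OF linear_wedge_dx] linear_add[OF linear_contract] linear_add[OF linear_star]
lemmas linear_negs = linear_neg[OF linear_wedge_dx] linear_neg[OF linear_contract] linear_neg[OF linear_star]
lemmas linear_zeros = linear_0[OF linear_wedge_dx] linear_0[OF linear_contract] linear_0[OF linear_star]

lemma star_wedge_x: "star_form (wedge_x \<omega>) = contract_x (star_form \<omega>)"
  by (simp add: star_form_def contract_x_def wedge_x_def linear_sums linear_scales star_wedge_dx)

lemma polynomial_function_star_form: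
  "polynomial_function \<omega> \<Longrightarrow> polynomial_function (star_form \<omega>)"
  unfolding star_form_def by (rule polynomial_function_bounded_linear_comp[OF bounded_linear_star])

lemma ext_deriv_star:
  assumes "polynomial_function \<omega>"
  shows "ext_deriv (star_form \<omega>) x = - star (codiff \<omega> x)"
  by (simp add: ext_deriv_def codiff_def star_form_def linear_sums linear_negs star_contract
      partial_deriv_bounded_linear_poly[OF bounded_linear_star assms])

lemma codiff_star:
  assumes "polynomial_function \<omega>"
  shows "codiff (star_form \<omega>) x = - star (ext_deriv \<omega> x)"
  by (simp add: ext_deriv_def codiff_def star_form_def linear_sums linear_negs star_wedge_dx
      partial_deriv_bounded_linear_poly[OF bounded_linear_star assms])

lemma polynomial_function_coordinate_scaleR:
  "polynomial_function \<omega> \<Longrightarrow> polynomial_function (\<lambda>x. x $ i *\<^sub>R \<omega> x)"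
  by (rule polynomial_function_mult)
     (simp_all add: real_polynomial_function_coordinate flip: real_polynomial_function_eq)

lemma polynomial_function_wedge_x: "polynomial_function \<omega> \<Longrightarrow> polynomial_function (wedge_x \<omega>)"
  unfolding wedge_x_def
  by (intro polynomial_function_sum polynomial_function_coordinate_scaleR
      polynomial_function_bounded_linear_comp[OF bounded_linear_wedge_dx]) auto

lemma polynomial_function_ext_deriv:
  assumes "polynomial_function \<omega>"
  shows "polynomial_function (ext_deriv \<omega>)"
  unfolding ext_deriv_def
  by (intro polynomial_function_sum polynomial_function_bounded_linear_comp[OF bounded_linear_wedge_dx]
      polynomial_function_partial_deriv assms) auto

lemma polynomial_function_codiff:
  assumes "polynomial_function \<omega>"
  shows "polynomial_function (codiff \<omega>)"
  unfolding codiff_def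
  by (intro polynomial_function_minus polynomial_function_sum
      polynomial_function_bounded_linear_comp[OF bounded_linear_contract]
      polynomial_function_partial_deriv assms) auto

lemma partial_deriv_contract_x:
  assumes "polynomial_function \<omega>"
  shows "partial_deriv i (contract_x \<omega>) x =
    contract i (\<omega> x) + (\<Sum>j\<in>UNIV. x $ j *\<^sub>R contract j (partial_deriv i \<omega> x))"
proof -
  have p: "polynomial_function (\<lambda>x. contract j (\<omega> x))" for j
    by (rule polynomial_function_bounded_linear_comp[OF bounded_linear_contract assms])
  have "partial_deriv i (contract_x \<omega>) x =
      (\<Sum>j\<in>UNIV. partial_deriv i (\<lambda>x. x $ j *\<^sub>R contract j (\<omega> x)) x)"
    unfolding contract_x_def
    by (subst partial_deriv_sum_poly_vec) (rule polynomial_function_coordinate_scaleR[OF p], rule refl)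
  also have "\<dots> = (\<Sum>j\<in>UNIV. x $ j *\<^sub>R contract j (partial_deriv i \<omega> x) +
      (if j = i then contract i (\<omega> x) else 0))"
  proof (rule sum.cong)
    fix j
    have "partial_deriv i (\<lambda>x. x $ j *\<^sub>R contract j (\<omega> x)) x =
        x $ j *\<^sub>R partial_deriv i (\<lambda>x. contract j (\<omega> x)) x + partial_deriv i (\<lambda>x. x $ j) x *\<^sub>R contract j (\<omega> x)"
      by (intro partial_deriv_scaleR differentiable_at_real_polynomial_function
          real_polynomial_function_coordinate differentiable_at_polynomial_function p)
    then show "partial_deriv i (\<lambda>x. x $ j *\<^sub>R contract j (\<omega> x)) x =
        x $ j *\<^sub>R contract j (partial_deriv i \<omega> x) + (if j = i then contract i (\<omega> x) else 0)"
      by (simp add: partial_deriv_coordinate partial_deriv_bounded_linear_poly[OF bounded_linear_contract assms])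
  qed simp
  finally show ?thesis by (simp add: sum.distrib add.commute)
qed

lemma eq_uminus_self: "(v::'a::real_vector) = - v \<Longrightarrow> v = 0"
  using scaleR_2[of v] by (metis add.right_inverse scale_eq_0_iff zero_neq_numeral)

text \<open>For the squares of \<open>ext_deriv\<close> and \<open>codiff\<close>, where symmetric
  second derivatives meet anticommuting operators.\<close>

lemma sum_antisym:
  fixes f :: "'a \<Rightarrow> 'a \<Rightarrow> 'b::real_vector"
  assumes "\<And>i j. f i j = - f j i"
  shows "(\<Sum>i\<in>A. \<Sum>j\<in>A. f i j) = 0"
proof -
  have "(\<Sum>i\<in>A. \<Sum>j\<in>A. f i j) = (\<Sum>i\<in>A. \<Sum>j\<in>A. f j i)" by (rule sum.swap)
  also have "\<dots> = (\<Sum>i\<in>A. \<Sum>j\<in>A. - f i j)" by (intro sum.cong refl assms)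
  also have "\<dots> = - (\<Sum>i\<in>A. \<Sum>j\<in>A. f i j)" by (simp add: sum_negf)
  finally show ?thesis by (rule eq_uminus_self)
qed

lemma partial_deriv_ext_deriv:
  assumes "polynomial_function \<omega>"
  shows "partial_deriv i (ext_deriv \<omega>) x = (\<Sum>j\<in>UNIV. wedge_dx j (partial_deriv i (partial_deriv j \<omega>) x))"
proof -
  note p = polynomial_function_partial_deriv[OF assms]
  show ?thesis
    unfolding ext_deriv_def
    by (subst partial_deriv_sum_poly_vec)
       (rule polynomial_function_bounded_linear_comp[OF bounded_linear_wedge_dx p],
        simp only: partial_deriv_bounded_linear_poly[OF bounded_linear_wedge_dx p])
qed

lemma partial_deriv_codiff:
  assumes "polynomial_function \<omega>"
  shows "partial_deriv i (codiff \<omega>) x = - (\<Sum>j\<in>UNIV. contract j (partial_deriv i (partial_deriv j \<omega>) x))"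
proof -
  note p = polynomial_function_partial_deriv[OF assms]
  have "partial_deriv i (codiff \<omega>) = (\<lambda>x. - (partial_deriv i (\<lambda>x. \<Sum>j\<in>UNIV. contract j (partial_deriv j \<omega> x)) x))"
    unfolding codiff_def
    by (rule partial_deriv_bounded_linear_poly[OF bounded_linear_minus[OF bounded_linear_ident]])
       (intro polynomial_function_sum finite polynomial_function_bounded_linear_comp[OF bounded_linear_contract] p)
  also have "partial_deriv i (\<lambda>x. \<Sum>j\<in>UNIV. contract j (partial_deriv j \<omega> x)) =
      (\<lambda>x. \<Sum>j\<in>UNIV. contract j (partial_deriv i (partial_deriv j \<omega>) x))"
    by (subst partial_deriv_sum_poly_vec)
       (rule polynomial_function_bounded_linear_comp[OF bounded_linear_contract p],
        simp only: partial_deriv_bounded_linear_poly[OF bounded_linear_contract p])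
  finally show ?thesis by simp
qed

lemma ext_deriv_ext_deriv:
  assumes "polynomial_function \<omega>"
  shows "ext_deriv (ext_deriv \<omega>) x = 0"
proof -
  have "ext_deriv (ext_deriv \<omega>) x =
      (\<Sum>i\<in>UNIV. \<Sum>j\<in>UNIV. wedge_dx i (wedge_dx j (partial_deriv i (partial_deriv j \<omega>) x)))"
    unfolding ext_deriv_def[of "ext_deriv \<omega>"] partial_deriv_ext_deriv[OF assms] by (simp add: linear_sums)
  also have "\<dots> = 0"
  proof (rule sum_antisym)
    show "wedge_dx i (wedge_dx j (partial_deriv i (partial_deriv j \<omega>) x)) =
        - wedge_dx j (wedge_dx i (partial_deriv j (partial_deriv i \<omega>) x))" for i j
      by (subst wedge_dx_wedge_dx, subst partial_deriv_commute[OF assms]) (rule refl)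
  qed
  finally show ?thesis .
qed

lemma codiff_codiff:
  assumes "polynomial_function \<omega>"
  shows "codiff (codiff \<omega>) x = 0"
proof -
  have "codiff (codiff \<omega>) x =
      (\<Sum>i\<in>UNIV. \<Sum>j\<in>UNIV. contract i (contract j (partial_deriv i (partial_deriv j \<omega>) x)))"
    unfolding codiff_def[of "codiff \<omega>"] partial_deriv_codiff[OF assms]
    by (simp add: linear_sums linear_negs sum_negf)
  also have "\<dots> = 0"
  proof (rule sum_antisym)
    show "contract i (contract j (partial_deriv i (partial_deriv j \<omega>) x)) =
        - contract j (contract i (partial_deriv j (partial_deriv i \<omega>) x))" for i j
      by (subst contract_contract, subst partial_deriv_commute[OF assms]) (rule refl)
  qed
  finally show ?thesis .
qed

text \<open>Second derivatives commute, so both compositions become sums over the same derivatives,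
  and \<open>wedge_dx_contract\<close> leaves only the diagonal.\<close>

lemma hodge_laplacian:
  assumes "polynomial_function \<omega>"
  shows "ext_deriv (codiff \<omega>) x + codiff (ext_deriv \<omega>) x = - (\<Sum>i\<in>UNIV. partial_deriv i (partial_deriv i \<omega>) x)"
proof -
  let ?D = "\<lambda>i j. partial_deriv i (partial_deriv j \<omega>) x"
  have "ext_deriv (codiff \<omega>) x = - (\<Sum>i\<in>UNIV. \<Sum>j\<in>UNIV. wedge_dx i (contract j (?D i j)))"
    unfolding ext_deriv_def partial_deriv_codiff[OF assms] by (simp add: linear_sums linear_negs sum_negf)
  moreover have "codiff (ext_deriv \<omega>) x = - (\<Sum>j\<in>UNIV. \<Sum>i\<in>UNIV. contract j (wedge_dx i (?D j i)))"
    unfolding codiff_def partial_deriv_ext_deriv[OF assms] by (simp add: linear_sums)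
  moreover have "(\<Sum>j\<in>UNIV. \<Sum>i\<in>UNIV. contract j (wedge_dx i (?D j i))) =
      (\<Sum>i\<in>UNIV. \<Sum>j\<in>UNIV. contract j (wedge_dx i (?D i j)))"
    by (subst sum.swap, subst partial_deriv_commute[OF assms]) (rule refl)
  ultimately have "ext_deriv (codiff \<omega>) x + codiff (ext_deriv \<omega>) x =
      - (\<Sum>i\<in>UNIV. \<Sum>j\<in>UNIV. wedge_dx i (contract j (?D i j)) + contract j (wedge_dx i (?D i j)))"
    by (simp add: sum.distrib)
  then show ?thesis by (simp add: wedge_dx_contract)
qed

text \<open>Differentiating the coordinates yields a repeated contraction with the same vector,
  which is 0; in the remaining terms the two contractions anticommute.\<close>

lemma codiff_contract_x:
  assumes "polynomial_function \<omega>"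
  shows "codiff (contract_x \<omega>) x = - contract_x (codiff \<omega>) x"
proof -
  have cc: "contract i (contract i v) = 0" for i and v :: "'a exterior"
    using contract_contract[of i i v] by (rule eq_uminus_self)
  have "codiff (contract_x \<omega>) x =
      - (\<Sum>i\<in>UNIV. \<Sum>j\<in>UNIV. x $ j *\<^sub>R contract i (contract j (partial_deriv i \<omega> x)))"
    unfolding codiff_def partial_deriv_contract_x[OF assms]
    by (simp add: linear_sums linear_adds linear_scales cc)
  also have "\<dots> = (\<Sum>j\<in>UNIV. \<Sum>i\<in>UNIV. x $ j *\<^sub>R contract j (contract i (partial_deriv i \<omega> x)))"
    by (subst sum.swap) (subst contract_contract, simp add: sum_negf)
  also have "\<dots> = - contract_x (codiff \<omega>) x"
    by (simp add: contract_x_def codiff_def linear_sums linear_negs scaleR_sum_right sum_negf)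
  finally show ?thesis .
qed

text \<open>Conjugation of \<open>codiff_contract_x\<close> by \<open>star\<close>. The sign is that
  of the product rule for the one-form with coefficients \<open>x $ i\<close>, which is closed,
  being the differential of |x|^2 / 2.\<close>

lemma ext_deriv_wedge_x:
  assumes "polynomial_function \<omega>"
  shows "ext_deriv (wedge_x \<omega>) x = - wedge_x (ext_deriv \<omega>) x"
proof -
  have s: "star_form (ext_deriv \<omega>) = (\<lambda>x. - codiff (star_form \<omega>) x)"
    by (rule ext) (simp add: codiff_star[OF assms] star_form_def[of "ext_deriv \<omega>"])
  have "star (ext_deriv (wedge_x \<omega>) x) = - codiff (star_form (wedge_x \<omega>)) x"
    by (simp add: codiff_star polynomial_function_wedge_x assms)
  also have "\<dots> = contract_x (codiff (star_form \<omega>)) x"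
    by (simp add: star_wedge_x codiff_contract_x polynomial_function_star_form assms)
  also have "\<dots> = - contract_x (star_form (ext_deriv \<omega>)) x"
    unfolding s by (simp add: contract_x_def linear_negs sum_negf)
  also have "\<dots> = star (- wedge_x (ext_deriv \<omega>) x)"
    by (simp add: linear_negs flip: star_wedge_x) (simp add: star_form_def)
  finally show ?thesis by (simp add: inj_star)
qed

text \<open>A set \<open>S\<close> of form degrees, rather than one degree, covers single degrees
  and mixed spaces alike. \<open>ext_deriv\<close> and \<open>wedge_x\<close> act on it by the image
  under \<open>Suc\<close>, \<open>codiff\<close> and \<open>contract_x\<close> by the preimage; the
  preimage of \<open>{0}\<close> is empty, so functions are coclosed without a special case.\<close>

definition graded_forms :: "nat \<Rightarrow> nat set \<Rightarrow> 'n::{finite,linorder} form set" where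
  "graded_forms k S =
     {\<omega>. \<forall>I. (\<lambda>x. \<omega> x $ I) \<in> homogeneous_polys k \<and> (card I \<notin> S \<longrightarrow> (\<forall>x. \<omega> x $ I = 0))}"

lemma poly_forms_eq: "poly_forms k s = graded_forms k {s}"
  by (simp add: poly_forms_def graded_forms_def)

lemma graded_formsI:
  "(\<And>I. (\<lambda>x. \<omega> x $ I) \<in> homogeneous_polys k) \<Longrightarrow> (\<And>I x. card I \<notin> S \<Longrightarrow> \<omega> x $ I = 0) \<Longrightarrow>
    \<omega> \<in> graded_forms k S"
  by (simp add: graded_forms_def)

lemma graded_forms_component:
  assumes "\<omega> \<in> graded_forms k S"
  shows "(\<lambda>x. \<omega> x $ I) \<in> homogeneous_polys k" "card I \<notin> S \<Longrightarrow> \<omega> x $ I = 0"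
  using assms by (auto simp: graded_forms_def)

lemma graded_forms_mono: "S \<subseteq> T \<Longrightarrow> graded_forms k S \<subseteq> graded_forms k T"
  by (auto simp: graded_forms_def)

lemma polynomial_function_graded_forms: "\<omega> \<in> graded_forms k S \<Longrightarrow> polynomial_function \<omega>"
  unfolding polynomial_function_vec using homogeneous_polys_poly graded_forms_component(1) by blast

lemma subspace_graded_forms: "fun_vs.subspace (graded_forms k S)"
  by (rule fun_vs.subspaceI)
     (auto simp: graded_forms_def fun_scaleR_def homogeneous_polys_0 homogeneous_polys_add homogeneous_polys_cmult)

lemma graded_forms_sum:
  "(\<And>a. a \<in> A \<Longrightarrow> \<omega> a \<in> graded_forms k S) \<Longrightarrow> (\<lambda>x. \<Sum>a\<in>A. \<omega> a x) \<in> graded_forms k S"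
  using fun_vs.subspace_sum[OF subspace_graded_forms, of A \<omega>] by (simp add: sum_fun_apply[abs_def])

lemma graded_forms_scaleR:
  "\<omega> \<in> graded_forms k S \<Longrightarrow> (\<lambda>x. c *\<^sub>R \<omega> x) \<in> graded_forms k S"
  using fun_vs.subspace_scale[OF subspace_graded_forms, of \<omega> k S c] by (simp add: fun_scaleR_def)

lemma graded_forms_uminus:
  "\<omega> \<in> graded_forms k S \<Longrightarrow> (\<lambda>x. - \<omega> x) \<in> graded_forms k S"
  using graded_forms_scaleR[of \<omega> k S "- 1"] by simp

lemma graded_forms_coordinate:
  "\<omega> \<in> graded_forms k S \<Longrightarrow> (\<lambda>x. x $ i *\<^sub>R \<omega> x) \<in> graded_forms (Suc k) S"
  by (simp add: graded_forms_def homogeneous_polys_coordinate_mult)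

lemma graded_forms_wedge_dx:
  assumes "\<omega> \<in> graded_forms k S"
  shows "(\<lambda>x. wedge_dx i (\<omega> x)) \<in> graded_forms k (Suc ` S)"
proof (rule graded_formsI)
  fix I
  show "(\<lambda>x. wedge_dx i (\<omega> x) $ I) \<in> homogeneous_polys k"
    using homogeneous_polys_cmult[OF graded_forms_component(1)[OF assms, of "I - {i}"], of "sgn_pos i I"]
      homogeneous_polys_0[of k]
    by (cases "i \<in> I") (simp_all only: wedge_dx_def vec_lambda_beta if_True if_False)
  fix x assume I: "card I \<notin> Suc ` S"
  show "wedge_dx i (\<omega> x) $ I = 0"
  proof (cases "i \<in> I")
    case True
    then have "card I = Suc (card (I - {i}))" by (intro card.remove) auto
    then have 0: "card (I - {i}) \<notin> S" using I imageI[of "card (I - {i})" S Suc] by auto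
    show ?thesis by (simp add: wedge_dx_def graded_forms_component(2)[OF assms 0])
  qed (simp add: wedge_dx_def)
qed

lemma graded_forms_contract:
  assumes "\<omega> \<in> graded_forms k S"
  shows "(\<lambda>x. contract i (\<omega> x)) \<in> graded_forms k (Suc -` S)"
proof (rule graded_formsI)
  fix I
  show "(\<lambda>x. contract i (\<omega> x) $ I) \<in> homogeneous_polys k"
    using homogeneous_polys_cmult[OF graded_forms_component(1)[OF assms, of "insert i I"], of "sgn_pos i I"]
      homogeneous_polys_0[of k]
    by (cases "i \<in> I") (simp_all only: contract_def vec_lambda_beta if_True if_False)
  show "contract i (\<omega> x) $ I = 0" if "card I \<notin> Suc -` S" for x
    using that graded_forms_component(2)[OF assms, of "insert i I"]
    by (cases "i \<in> I") (auto simp: contract_def)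
qed

lemma graded_forms_star:
  fixes \<omega> :: "'n::{finite,linorder} form"
  assumes "\<omega> \<in> graded_forms k {s}" "s \<le> CARD('n)"
  shows "star_form \<omega> \<in> graded_forms k {CARD('n) - s}"
proof (rule graded_formsI)
  show "(\<lambda>x. star_form \<omega> x $ I) \<in> homogeneous_polys k" for I
    using homogeneous_polys_cmult[OF graded_forms_component(1)[OF assms(1), of "- I"], of "star_sign I"]
    by (simp only: star_form_def star_def vec_lambda_beta)
  show "star_form \<omega> x $ I = 0" if "card I \<notin> {CARD('n) - s}" for I x
  proof -
    have "card (- I) = CARD('n) - card I"
      unfolding Compl_eq_Diff_UNIV by (rule card_Diff_subset) auto
    moreover have "card I \<le> CARD('n)" by (rule card_mono) auto
    ultimately have "card (- I) \<notin> {s}" using that assms(2) by auto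
    from graded_forms_component(2)[OF assms(1) this] show ?thesis
      by (simp add: star_form_def star_def)
  qed
qed

lemma graded_forms_partial_deriv:
  assumes "\<omega> \<in> graded_forms k S"
  shows "partial_deriv i \<omega> \<in> graded_forms (k - 1) S"
    and "k = 0 \<Longrightarrow> partial_deriv i \<omega> x = 0"
proof -
  note c = graded_forms_component[OF assms]
  have p: "partial_deriv i \<omega> x $ I = partial_deriv i (\<lambda>x. \<omega> x $ I) x" for x I
    by (rule partial_deriv_component[OF polynomial_function_graded_forms[OF assms]])
  show "partial_deriv i \<omega> \<in> graded_forms (k - 1) S"
  proof (rule graded_formsI)
    show "(\<lambda>x. partial_deriv i \<omega> x $ I) \<in> homogeneous_polys (k - 1)" for I
      unfolding p using partial_deriv_homogeneous(1)[OF c(1)] .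
    show "partial_deriv i \<omega> x $ I = 0" if "card I \<notin> S" for I x
      unfolding p by (simp add: c(2)[OF that] partial_deriv_const)
  qed
  show "partial_deriv i \<omega> x = 0" if "k = 0"
    using that partial_deriv_homogeneous(2)[OF c(1)] by (simp add: vec_eq_iff p)
qed

lemma graded_forms_ext_deriv:
  "\<omega> \<in> graded_forms k S \<Longrightarrow> ext_deriv \<omega> \<in> graded_forms (k - 1) (Suc ` S)"
  unfolding ext_deriv_def
  by (intro graded_forms_sum graded_forms_wedge_dx graded_forms_partial_deriv(1))

lemma graded_forms_codiff:
  "\<omega> \<in> graded_forms k S \<Longrightarrow> codiff \<omega> \<in> graded_forms (k - 1) (Suc -` S)"
  unfolding codiff_def
  by (intro graded_forms_uminus graded_forms_sum graded_forms_contract graded_forms_partial_deriv(1))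

lemma graded_forms_contract_x:
  "\<omega> \<in> graded_forms k S \<Longrightarrow> contract_x \<omega> \<in> graded_forms (Suc k) (Suc -` S)"
  unfolding contract_x_def
  by (intro graded_forms_sum graded_forms_coordinate graded_forms_contract)

lemma graded_forms_wedge_x:
  "\<omega> \<in> graded_forms k S \<Longrightarrow> wedge_x \<omega> \<in> graded_forms (Suc k) (Suc ` S)"
  unfolding wedge_x_def
  by (intro graded_forms_sum graded_forms_coordinate graded_forms_wedge_dx)

lemma ext_deriv_degree_0: "\<omega> \<in> graded_forms 0 S \<Longrightarrow> ext_deriv \<omega> = 0"
  by (simp add: ext_deriv_def graded_forms_partial_deriv(2) linear_zeros zero_fun_def)

lemma codiff_degree_0: "\<omega> \<in> graded_forms 0 S \<Longrightarrow> codiff \<omega> = 0"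
  by (simp add: codiff_def graded_forms_partial_deriv(2) linear_zeros zero_fun_def)

lemma ext_deriv_add:
  assumes "polynomial_function \<omega>" "polynomial_function \<eta>"
  shows "ext_deriv (\<omega> + \<eta>) = ext_deriv \<omega> + ext_deriv \<eta>"
  using assms
  by (simp add: fun_eq_iff ext_deriv_def plus_fun_def partial_deriv_add linear_adds
      differentiable_at_polynomial_function sum.distrib)

lemma codiff_add:
  assumes "polynomial_function \<omega>" "polynomial_function \<eta>"
  shows "codiff (\<omega> + \<eta>) = codiff \<omega> + codiff \<eta>"
  using assms
  by (simp add: fun_eq_iff codiff_def plus_fun_def partial_deriv_add linear_adds
      differentiable_at_polynomial_function sum.distrib)

lemma ext_deriv_scale:
  assumes "polynomial_function \<omega>"
  shows "ext_deriv (fun_scaleR c \<omega>) = fun_scaleR c (ext_deriv \<omega>)"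
  using partial_deriv_bounded_linear_poly[OF bounded_linear_scaleR_right assms]
  by (simp add: fun_eq_iff ext_deriv_def fun_scaleR_def linear_scales scaleR_sum_right)

lemma codiff_scale:
  assumes "polynomial_function \<omega>"
  shows "codiff (fun_scaleR c \<omega>) = fun_scaleR c (codiff \<omega>)"
  using partial_deriv_bounded_linear_poly[OF bounded_linear_scaleR_right assms]
  by (simp add: fun_eq_iff codiff_def fun_scaleR_def linear_scales scaleR_sum_right)

lemma euler_graded_forms:
  assumes "\<omega> \<in> graded_forms k S"
  shows "(\<Sum>i\<in>UNIV. x $ i *\<^sub>R partial_deriv i \<omega> x) = of_nat k *\<^sub>R \<omega> x"
  using euler_homogeneous[OF graded_forms_component(1)[OF assms]]
  by (simp add: vec_eq_iff partial_deriv_component[OF polynomial_function_graded_forms[OF assms]])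

(* Cartan's formula for the Euler field: its Lie derivative acts on these forms as k + s. *)
lemma ext_deriv_contract_x:
  assumes "\<omega> \<in> graded_forms k {s}"
  shows "ext_deriv (contract_x \<omega>) x + contract_x (ext_deriv \<omega>) x = of_nat (k + s) *\<^sub>R \<omega> x"
proof -
  let ?D = "\<lambda>i. partial_deriv i \<omega> x"
  note p = polynomial_function_graded_forms[OF assms]
  have "(\<Sum>i\<in>UNIV. wedge_dx i (contract i (\<omega> x))) = of_nat s *\<^sub>R \<omega> x"
    using graded_forms_component(2)[OF assms]
    by (auto simp: vec_eq_iff sum_wedge_dx_contract_component simp del: sum_component)
  then have "ext_deriv (contract_x \<omega>) x = of_nat s *\<^sub>R \<omega> x +
      (\<Sum>i\<in>UNIV. \<Sum>j\<in>UNIV. x $ j *\<^sub>R wedge_dx i (contract j (?D i)))"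
    unfolding ext_deriv_def partial_deriv_contract_x[OF p]
    by (simp add: linear_adds linear_sums linear_scales sum.distrib)
  moreover have "contract_x (ext_deriv \<omega>) x =
      (\<Sum>i\<in>UNIV. \<Sum>j\<in>UNIV. x $ j *\<^sub>R contract j (wedge_dx i (?D i)))"
    unfolding ext_deriv_def contract_x_def
    by (subst sum.swap) (simp add: linear_sums scaleR_sum_right)
  ultimately have "ext_deriv (contract_x \<omega>) x + contract_x (ext_deriv \<omega>) x = of_nat s *\<^sub>R \<omega> x +
      (\<Sum>i\<in>UNIV. \<Sum>j\<in>UNIV. x $ j *\<^sub>R (wedge_dx i (contract j (?D i)) + contract j (wedge_dx i (?D i))))"
    by (simp add: sum.distrib scaleR_add_right)
  also have "\<dots> = of_nat s *\<^sub>R \<omega> x + (\<Sum>i\<in>UNIV. \<Sum>j\<in>UNIV. if i = j then x $ i *\<^sub>R ?D i else 0)"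
    by (intro arg_cong2[where f = "(+)"] sum.cong refl) (auto simp: wedge_dx_contract)
  also have "\<dots> = of_nat (k + s) *\<^sub>R \<omega> x"
    using euler_graded_forms[OF assms] by (simp add: scaleR_add_left)
  finally show ?thesis .
qed

text \<open>\<open>star\<close> turns \<open>wedge_x\<close> into \<open>contract_x\<close> and
  \<open>codiff\<close> into minus \<open>ext_deriv\<close>, so this is Cartan's formula for
  \<open>star_form \<omega>\<close>, of form degree \<open>CARD('n) - s\<close>.\<close>

lemma codiff_wedge_x:
  fixes \<omega> :: "'n::{finite,linorder} form"
  assumes \<omega>: "\<omega> \<in> graded_forms k {s}" and "s \<le> CARD('n)"
  shows "codiff (wedge_x \<omega>) x + wedge_x (codiff \<omega>) x = - of_nat (k + (CARD('n) - s)) *\<^sub>R \<omega> x"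
proof -
  note p = polynomial_function_graded_forms[OF \<omega>]
  note st = graded_forms_star[OF assms]
  have "ext_deriv (contract_x (star_form \<omega>)) x = star (- codiff (wedge_x \<omega>) x)"
    by (simp add: linear_negs ext_deriv_star polynomial_function_wedge_x p flip: star_wedge_x)
  moreover have "contract_x (ext_deriv (star_form \<omega>)) x = star (- wedge_x (codiff \<omega>) x)"
  proof -
    have "contract_x (ext_deriv (star_form \<omega>)) x = - contract_x (star_form (codiff \<omega>)) x"
      by (simp add: contract_x_def ext_deriv_star[OF p] linear_negs sum_negf star_form_def[of "codiff \<omega>"])
    also have "\<dots> = star (- wedge_x (codiff \<omega>) x)"
      by (simp add: linear_negs flip: star_wedge_x) (simp add: star_form_def)
    finally show ?thesis .
  qed
  ultimately have "star (- (codiff (wedge_x \<omega>) x + wedge_x (codiff \<omega>) x)) =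
      star (of_nat (k + (CARD('n) - s)) *\<^sub>R \<omega> x)"
    using ext_deriv_contract_x[OF st, of x]
    by (simp add: linear_adds(3) linear_negs(3) linear_scales(3) linear_diff[OF linear_star] star_form_def)
  then have "- (codiff (wedge_x \<omega>) x + wedge_x (codiff \<omega>) x) = of_nat (k + (CARD('n) - s)) *\<^sub>R \<omega> x"
    unfolding inj_star .
  then show ?thesis by (metis minus_minus scaleR_minus_left)
qed

subsection \<open>Dimensions\<close>

global_interpretation fun_vs_pair:
  vector_space_pair "fun_scaleR :: real \<Rightarrow> ('a \<Rightarrow> 'b::real_vector) \<Rightarrow> 'a \<Rightarrow> 'b"
    "fun_scaleR :: real \<Rightarrow> ('c \<Rightarrow> 'd::real_vector) \<Rightarrow> 'c \<Rightarrow> 'd"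
  by intro_locales

text \<open>The basis consists of the products of a monomial of degree \<open>k\<close> and a basis
  monomial of the exterior algebra. The second claim feeds the finiteness hypothesis of
  \<open>rank_nullity\<close>.\<close>

lemma dim_graded_forms:
  "fun_vs.dim (graded_forms k S :: 'n::{finite,linorder} form set) =
    (k + CARD('n) - 1 choose k) * card {I :: 'n set. card I \<in> S}"
  "\<exists>B. finite B \<and> (graded_forms k S :: 'n form set) \<subseteq> fun_vs.span B"
proof -
  define A where "A = (multi_indices k :: ('n \<Rightarrow> nat) set) \<times> {I :: 'n set. card I \<in> S}"
  define b :: "('n \<Rightarrow> nat) \<times> 'n set \<Rightarrow> 'n form"
    where "b a = (\<lambda>x. monomial (fst a) x *\<^sub>R axis (snd a) 1)" for a
  have finA: "finite A" by (simp add: A_def finite_multi_indices)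
  have comp: "(\<Sum>a\<in>A. fun_scaleR (c a) (b a)) x $ I =
      (if card I \<in> S then \<Sum>\<alpha>\<in>multi_indices k. c (\<alpha>, I) * monomial \<alpha> x else 0)" for c x I
  proof -
    have "(\<Sum>a\<in>A. fun_scaleR (c a) (b a)) x $ I =
        (\<Sum>a\<in>A. if I = snd a then c a * monomial (fst a) x else 0)"
      unfolding sum_fun_apply sum_component
      by (rule sum.cong) (auto simp: fun_scaleR_def b_def axis_def)
    also have "\<dots> = (\<Sum>\<alpha>\<in>multi_indices k. \<Sum>J | card J \<in> S. if I = J then c (\<alpha>, J) * monomial \<alpha> x else 0)"
      unfolding A_def sum.cartesian_product by (rule sum.cong) (simp_all add: case_prod_unfold)
    also have "\<dots> = (if card I \<in> S then \<Sum>\<alpha>\<in>multi_indices k. c (\<alpha>, I) * monomial \<alpha> x else 0)"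
      by simp
    finally show ?thesis .
  qed
  have V: "graded_forms k S = {\<Sum>a\<in>A. fun_scaleR (c a) (b a) | c. True}"
  proof (intro subset_antisym subsetI)
    fix \<omega> :: "'n form" assume \<omega>: "\<omega> \<in> graded_forms k S"
    have "\<exists>c. (\<lambda>x. \<omega> x $ I) = (\<lambda>x. \<Sum>\<alpha>\<in>multi_indices k. c \<alpha> * monomial \<alpha> x)" for I
      using homogeneous_polysE[OF graded_forms_component(1)[OF \<omega>, of I]] by metis
    then obtain c where c: "\<And>I. (\<lambda>x. \<omega> x $ I) = (\<lambda>x. \<Sum>\<alpha>\<in>multi_indices k. c I \<alpha> * monomial \<alpha> x)"
      by metis
    have "\<omega> x $ I = (\<Sum>a\<in>A. fun_scaleR (c (snd a) (fst a)) (b a)) x $ I" for x I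
      using fun_cong[OF c[of I], of x] graded_forms_component(2)[OF \<omega>, of I x]
      by (subst comp) (cases "card I \<in> S"; simp)
    then have "\<omega> = (\<Sum>a\<in>A. fun_scaleR (c (snd a) (fst a)) (b a))"
      by (simp add: fun_eq_iff vec_eq_iff)
    then show "\<omega> \<in> {\<Sum>a\<in>A. fun_scaleR (c a) (b a) | c. True}"
      by (intro CollectI exI[of _ "\<lambda>a. c (snd a) (fst a)"]) simp
  next
    fix \<omega> :: "'n form" assume "\<omega> \<in> {\<Sum>a\<in>A. fun_scaleR (c a) (b a) | c. True}"
    then obtain c where \<omega>: "\<omega> = (\<Sum>a\<in>A. fun_scaleR (c a) (b a))" by blast
    show "\<omega> \<in> graded_forms k S"
    proof (rule graded_formsI)
      have "(\<lambda>x. \<Sum>\<alpha>\<in>multi_indices k. c (\<alpha>, I) * monomial \<alpha> x) \<in> homogeneous_polys k" for I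
        by (intro homogeneous_polys_sum homogeneous_polys_cmult monomial_in_homogeneous_polys)
      then show "(\<lambda>x. \<omega> x $ I) \<in> homogeneous_polys k" for I
        unfolding \<omega> comp by (cases "card I \<in> S") (simp_all add: homogeneous_polys_0)
      show "\<omega> x $ I = 0" if "card I \<notin> S" for I x
        unfolding \<omega> comp using that by simp
    qed
  qed
  have indep: "c a = 0" if c: "(\<Sum>a\<in>A. fun_scaleR (c a) (b a)) = 0" and a: "a \<in> A" for c a
  proof -
    have "(\<Sum>\<alpha>\<in>multi_indices k. c (\<alpha>, snd a) * monomial \<alpha> x) = 0" for x
      using comp[of c x "snd a"] a unfolding c by (auto simp: A_def)
    then have "c (fst a, snd a) = 0"
      using a by (intro monomials_independent[where c = "\<lambda>\<alpha>. c (\<alpha>, snd a)"]) (auto simp: A_def)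
    then show ?thesis by simp
  qed
  have "fun_vs.dim (graded_forms k S :: 'n form set) = card A"
    by (rule fun_vs.dim_eq_card_of_coordinates(1)[OF finA V]) (rule indep)
  then show "fun_vs.dim (graded_forms k S :: 'n form set) =
      (k + CARD('n) - 1 choose k) * card {I :: 'n set. card I \<in> S}"
    by (simp add: A_def card_cartesian_product card_multi_indices)
  show "\<exists>B. finite B \<and> (graded_forms k S :: 'n form set) \<subseteq> fun_vs.span B"
    by (rule fun_vs.dim_eq_card_of_coordinates(2)[OF finA V]) (rule indep)
qed

lemma dim_graded_forms_single:
  "fun_vs.dim (graded_forms k {s} :: 'n::{finite,linorder} form set) =
    (k + CARD('n) - 1 choose k) * (CARD('n) choose s)"
  using n_subsets[of "UNIV :: 'n set" s] by (simp add: dim_graded_forms)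

lemma dim_kernel_image:
  fixes f :: "'n::{finite,linorder} form \<Rightarrow> 'n form"
  assumes "fun_vs.subspace V" "V \<subseteq> graded_forms k S"
    and "\<And>x y. x \<in> V \<Longrightarrow> y \<in> V \<Longrightarrow> f (x + y) = f x + f y"
    and "\<And>c x. x \<in> V \<Longrightarrow> f (fun_scaleR c x) = fun_scaleR c (f x)"
  shows "fun_vs.dim V = fun_vs.dim {v \<in> V. f v = 0} + fun_vs.dim (f ` V)"
proof -
  obtain B :: "'n form set" where "finite B" "graded_forms k S \<subseteq> fun_vs.span B"
    using dim_graded_forms(2) by blast
  then show ?thesis
    using assms by (intro fun_vs_pair.rank_nullity[where B = B]) auto
qed

section \<open>Closed, coclosed and harmonic forms\<close>

definition closed_forms :: "nat \<Rightarrow> nat set \<Rightarrow> 'n::{finite,linorder} form set" where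
  "closed_forms k S = {\<omega> \<in> graded_forms k S. ext_deriv \<omega> = 0}"

definition coclosed_forms :: "nat \<Rightarrow> nat set \<Rightarrow> 'n::{finite,linorder} form set" where
  "coclosed_forms k S = {\<omega> \<in> graded_forms k S. codiff \<omega> = 0}"

text \<open>Harmonic here means closed and coclosed, which is stronger than being annihilated by the
  Laplacian: a nonzero linear function is in the kernel of the Laplacian without being
  closed.\<close>

definition harmonic_forms :: "nat \<Rightarrow> nat set \<Rightarrow> 'n::{finite,linorder} form set" where
  "harmonic_forms k S = {\<omega> \<in> closed_forms k S. codiff \<omega> = 0}"

lemmas graded_linear =
  ext_deriv_add[OF polynomial_function_graded_forms polynomial_function_graded_forms]
  ext_deriv_scale[OF polynomial_function_graded_forms]
  codiff_add[OF polynomial_function_graded_forms polynomial_function_graded_forms]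
  codiff_scale[OF polynomial_function_graded_forms]

lemma subspace_closed_forms: "fun_vs.subspace (closed_forms k S)"
  unfolding closed_forms_def
  by (rule fun_vs_pair.subspace_kernel_on[OF subspace_graded_forms]) (rule graded_linear; assumption)+

text \<open>The polynomial Poincare lemma: on a closed \<open>\<eta>\<close>, Cartan's formula
  reduces to its first term, so \<open>contract_x \<eta>\<close> divided by \<open>k + Suc s\<close>
  is a primitive. The divisor is positive because the form degree is.\<close>

lemma image_ext_deriv:
  "ext_deriv ` graded_forms (Suc k) {s} = closed_forms k {Suc s}"
proof (intro subset_antisym subsetI)
  fix \<eta> :: "'a form" assume "\<eta> \<in> ext_deriv ` graded_forms (Suc k) {s}"
  then obtain \<omega> where \<omega>: "\<omega> \<in> graded_forms (Suc k) {s}" "\<eta> = ext_deriv \<omega>" by auto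
  show "\<eta> \<in> closed_forms k {Suc s}"
    unfolding \<omega>(2) using graded_forms_ext_deriv[OF \<omega>(1)] ext_deriv_ext_deriv[OF polynomial_function_graded_forms[OF \<omega>(1)]]
    by (auto simp: closed_forms_def fun_eq_iff)
next
  fix \<eta> :: "'a form" assume "\<eta> \<in> closed_forms k {Suc s}"
  then have \<eta>: "\<eta> \<in> graded_forms k {Suc s}" "ext_deriv \<eta> = 0" by (auto simp: closed_forms_def)
  define c where "c = 1 / real (k + Suc s)"
  have \<omega>: "contract_x \<eta> \<in> graded_forms (Suc k) {s}"
    using graded_forms_contract_x[OF \<eta>(1)] by (simp add: vimage_def)
  have "ext_deriv (contract_x \<eta>) x = real (k + Suc s) *\<^sub>R \<eta> x" for x
    using ext_deriv_contract_x[OF \<eta>(1), of x] by (simp add: \<eta>(2) contract_x_def linear_zeros)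
  then have "ext_deriv (fun_scaleR c (contract_x \<eta>)) = \<eta>"
    unfolding graded_linear(2)[OF \<omega>]
    by (simp add: fun_eq_iff fun_scaleR_def c_def del: of_nat_add of_nat_Suc)
  moreover have "fun_scaleR c (contract_x \<eta>) \<in> graded_forms (Suc k) {s}"
    by (rule fun_vs.subspace_scale[OF subspace_graded_forms \<omega>])
  ultimately show "\<eta> \<in> ext_deriv ` graded_forms (Suc k) {s}" by (metis imageI)
qed

lemma dim_closed_forms_Suc:
  "fun_vs.dim (graded_forms (Suc k) {s} :: 'n::{finite,linorder} form set) =
    fun_vs.dim (closed_forms (Suc k) {s} :: 'n form set) + fun_vs.dim (closed_forms k {Suc s} :: 'n form set)"
  unfolding image_ext_deriv[symmetric] closed_forms_def[of "Suc k" "{s}"]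
  by (rule dim_kernel_image[OF subspace_graded_forms subset_refl]) (rule graded_linear; assumption)+

text \<open>The recursion \<open>dim_closed_forms_Suc\<close> for the numbers in
  \<open>dim_closed_forms\<close>. Pascal's rule splits the first binomial, one piece absorbs the
  second product, and counting subsets of subsets brings out the common factor
  \<open>?N choose Suc k\<close>; Pascal's rule for \<open>m = Suc n\<close> then finishes.\<close>

lemma choose_hook_identity:
  assumes "m \<ge> 1"
  shows "(Suc k + m choose (Suc k + s)) * (Suc k + s - 1 choose Suc k) +
    (k + m choose (k + Suc s)) * (k + Suc s - 1 choose k) = (Suc k + m - 1 choose Suc k) * (m choose s)"
proof -
  obtain n where n: "m = Suc n" using assms by (cases m) auto
  let ?N = "k + m"
  have a: "(?N choose (k + s)) * (k + s choose Suc k) = (?N choose Suc k) * (if s = 0 then 0 else n choose (s - 1))"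
  proof (cases "s = 0 \<or> s > m")
    case False
    then have "(?N choose (k + s)) * (k + s choose Suc k) = (?N choose Suc k) * (?N - Suc k choose (k + s - Suc k))"
      by (intro choose_mult) auto
    moreover have "k + s - Suc k = s - 1" "?N - Suc k = n" using False n by auto
    ultimately show ?thesis using False by simp
  qed (auto simp: n binomial_eq_0)
  have b: "(?N choose (Suc k + s)) * (Suc k + s choose Suc k) = (?N choose Suc k) * (n choose s)"
  proof (cases "s \<ge> m")
    case False
    then have "(?N choose (Suc k + s)) * (Suc k + s choose Suc k) = (?N choose Suc k) * (?N - Suc k choose (Suc k + s - Suc k))"
      by (intro choose_mult) auto
    moreover have "?N - Suc k = n" using n by auto
    ultimately show ?thesis by simp
  next
    case True
    then have "?N choose (Suc k + s) = 0" "n choose s = 0" using n by (auto intro!: binomial_eq_0)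
    then show ?thesis by (simp only: mult_0 mult_0_right)
  qed
  have "(Suc k + m choose (Suc k + s)) * (k + s choose Suc k) + (?N choose (Suc k + s)) * (k + s choose k) =
      (?N choose (k + s)) * (k + s choose Suc k) + (?N choose (Suc k + s)) * (Suc k + s choose Suc k)"
    by (simp add: algebra_simps)
  also have "\<dots> = (?N choose Suc k) * (m choose s)"
    unfolding a b by (cases s) (simp_all add: n algebra_simps)
  finally show ?thesis by simp
qed

text \<open>For \<open>1 \<le> s\<close> and \<open>s \<le> m\<close> this is the dimension of the
  irreducible representation of GL_m of hook shape (k + 1, 1^(s - 1)). For \<open>s = 0\<close> it
  is 0, except that at \<open>k = 0\<close> the truncated \<open>k + s - 1\<close> gives 1, the
  dimension of the constants. \<open>s\<close> varies in the induction because
  \<open>ext_deriv\<close> lowers \<open>k\<close> and raises \<open>s\<close>.\<close>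

lemma dim_closed_forms:
  "fun_vs.dim (closed_forms k {s} :: 'n::{finite,linorder} form set) =
    (k + CARD('n) choose (k + s)) * (k + s - 1 choose k)"
proof (induction k arbitrary: s)
  case 0
  have "closed_forms 0 {s} = (graded_forms 0 {s} :: 'n form set)"
    using ext_deriv_degree_0 by (auto simp: closed_forms_def)
  then show ?case by (simp add: dim_graded_forms_single)
next
  case (Suc k)
  have "CARD('n) \<ge> 1" by (simp add: Suc_le_eq)
  from choose_hook_identity[OF this, of k s] show ?case
    using dim_closed_forms_Suc[where 'n = 'n, of k s] Suc.IH[of "Suc s"] dim_graded_forms_single[where 'n = 'n, of "Suc k" s]
    by linarith
qed

lemma star_star: "star (star v) = star_sign (UNIV :: 'n set) *\<^sub>R v"
  for v :: "'n::{finite,linorder} exterior"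
proof -
  have "star_sign I * star_sign (- I) = star_sign (UNIV :: 'n set)" for I :: "'n set"
    unfolding star_sign_def by (subst prod.union_disjoint[symmetric]) auto
  then show ?thesis by (simp add: vec_eq_iff star_def mult.assoc[symmetric])
qed

lemma star_form_closed_iff:
  assumes "polynomial_function \<omega>"
  shows "ext_deriv (star_form \<omega>) = 0 \<longleftrightarrow> codiff \<omega> = 0" "codiff (star_form \<omega>) = 0 \<longleftrightarrow> ext_deriv \<omega> = 0"
  by (simp_all add: fun_eq_iff ext_deriv_star[OF assms] codiff_star[OF assms] star_eq_0_iff)

lemma image_star_form:
  assumes "s \<le> CARD('n::{finite,linorder})"
  shows "star_form ` closed_forms k {CARD('n) - s} = (coclosed_forms k {s} :: 'n form set)"
proof (intro subset_antisym subsetI)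
  fix \<eta> :: "'n form" assume "\<eta> \<in> star_form ` closed_forms k {CARD('n) - s}"
  then show "\<eta> \<in> coclosed_forms k {s}"
    using assms graded_forms_star[where 'n = 'n, of _ k "CARD('n) - s"]
    by (auto simp: closed_forms_def coclosed_forms_def star_form_closed_iff polynomial_function_graded_forms)
next
  fix \<eta> :: "'n form" assume "\<eta> \<in> coclosed_forms k {s}"
  then have \<eta>: "\<eta> \<in> graded_forms k {s}" "codiff \<eta> = 0" by (auto simp: coclosed_forms_def)
  define c where "c = 1 / star_sign (UNIV :: 'n set)"
  have st: "star_form \<eta> \<in> closed_forms k {CARD('n) - s}"
    using \<eta> assms graded_forms_star[OF \<eta>(1)]
    by (auto simp: closed_forms_def star_form_closed_iff polynomial_function_graded_forms)
  have "star_form (fun_scaleR c (star_form \<eta>)) = \<eta>"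
    by (simp add: fun_eq_iff star_form_def fun_scaleR_def linear_scales star_star c_def star_sign_nonzero)
  moreover have "fun_scaleR c (star_form \<eta>) \<in> closed_forms k {CARD('n) - s}"
    by (rule fun_vs.subspace_scale[OF subspace_closed_forms st])
  ultimately show "\<eta> \<in> star_form ` closed_forms k {CARD('n) - s}" by (metis imageI)
qed

lemma fun_vs_dim_0: "fun_vs.dim {0 :: 'a \<Rightarrow> 'b::real_vector} = 0"
  using fun_vs.dim_span_eq_card_independent[of "{} :: ('a \<Rightarrow> 'b) set"] fun_vs.independent_empty by simp

lemma dim_coclosed_forms:
  assumes "s \<le> CARD('n::{finite,linorder})"
  shows "fun_vs.dim (coclosed_forms k {s} :: 'n form set) = fun_vs.dim (closed_forms k {CARD('n) - s} :: 'n form set)"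
proof -
  have "fun_vs.dim (closed_forms k {CARD('n) - s} :: 'n form set) =
      fun_vs.dim {v \<in> closed_forms k {CARD('n) - s} :: 'n form set. star_form v = 0} +
      fun_vs.dim (star_form ` (closed_forms k {CARD('n) - s} :: 'n form set))"
    by (rule dim_kernel_image[where k = k and S = "{CARD('n) - s}", OF subspace_closed_forms])
       (auto simp: closed_forms_def star_form_def fun_eq_iff fun_scaleR_def linear_adds linear_scales)
  moreover have "{v \<in> closed_forms k {CARD('n) - s} :: 'n form set. star_form v = 0} = {0}"
    using fun_vs.subspace_0[OF subspace_closed_forms]
    by (auto simp: star_form_def fun_eq_iff star_eq_0_iff)
  ultimately show ?thesis by (simp add: image_star_form[OF assms] fun_vs_dim_0)
qed

text \<open>\<open>laplacian_onto\<close>, applied to each coefficient, gives \<open>\<eta>\<close>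
  of degree \<open>k + 2\<close> whose Hodge Laplacian is \<open>\<omega>\<close>; its two terms are
  the summands. The two spaces overlap in the harmonic forms, so the summands are not unique in
  general.\<close>

lemma closed_coclosed_decomposition:
  fixes \<omega> :: "'n::{finite,linorder} form"
  assumes "\<omega> \<in> graded_forms k {s}"
  obtains \<alpha> \<beta> where "\<omega> = \<alpha> + \<beta>" "\<alpha> \<in> closed_forms k {s}" "\<beta> \<in> coclosed_forms k {s}"
proof -
  \<comment> \<open>The minus sign is that of \<open>hodge_laplacian\<close>. Outside form degree
    \<open>s\<close> the preimage 0 is chosen, so that \<open>\<eta>\<close> is homogeneous in form
    degree as well.\<close>
  have "\<exists>g \<in> homogeneous_polys (k + 2). (\<forall>x. laplacian g x = - \<omega> x $ I) \<and> (card I \<noteq> s \<longrightarrow> (\<forall>x. g x = 0))" for I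
  proof (cases "card I = s")
    case True
    have "(\<lambda>x. - \<omega> x $ I) \<in> homogeneous_polys k"
      using homogeneous_polys_cmult[OF graded_forms_component(1)[OF assms, of I], of "- 1"] by simp
    from laplacian_onto[OF this] True show ?thesis by blast
  next
    case False
    then have "\<omega> x $ I = 0" for x using graded_forms_component(2)[OF assms] by simp
    then show ?thesis
      using homogeneous_polys_0[of "k + 2"]
      by (intro bexI[of _ "\<lambda>x. 0"]) (simp_all add: laplacian_def partial_deriv_const[abs_def])
  qed
  then obtain g where g: "\<And>I. g I \<in> homogeneous_polys (k + 2)" "\<And>I x. laplacian (g I) x = - \<omega> x $ I"
    "\<And>I x. card I \<noteq> s \<Longrightarrow> g I x = 0" by metis
  define \<eta> :: "'n form" where "\<eta> x = (\<chi> I. g I x)" for x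
  have \<eta>: "\<eta> \<in> graded_forms (k + 2) {s}"
  proof (rule graded_formsI)
    show "(\<lambda>x. \<eta> x $ I) \<in> homogeneous_polys (k + 2)" for I
      using g(1)[of I] by (simp add: \<eta>_def)
  qed (simp add: \<eta>_def g(3))
  note p = polynomial_function_graded_forms[OF \<eta>]
  have comp: "(\<lambda>x. \<eta> x $ I) = g I" for I by (simp add: \<eta>_def)
  have "ext_deriv (codiff \<eta>) x + codiff (ext_deriv \<eta>) x = \<omega> x" for x
  proof -
    have "(\<Sum>i\<in>UNIV. partial_deriv i (partial_deriv i \<eta>) x) $ I = laplacian (g I) x" for I
      by (simp add: laplacian_def partial_deriv_component[OF p] comp
          partial_deriv_component[OF polynomial_function_partial_deriv[OF p]])
    then show ?thesis unfolding hodge_laplacian[OF p] by (simp add: vec_eq_iff g(2) del: sum_component)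
  qed
  then have "\<omega> = ext_deriv (codiff \<eta>) + codiff (ext_deriv \<eta>)" by (simp add: fun_eq_iff)
  moreover have "ext_deriv (codiff \<eta>) \<in> closed_forms k {s}"
  proof -
    have "ext_deriv (codiff \<eta>) \<in> graded_forms (k + 2 - 1 - 1) (Suc ` Suc -` {s})"
      by (intro graded_forms_ext_deriv graded_forms_codiff \<eta>)
    \<comment> \<open>An inclusion, not an equation: for \<open>s = 0\<close> the set of degrees on
      the left is empty.\<close>
    moreover have "graded_forms (k + 2 - 1 - 1) (Suc ` Suc -` {s}) \<subseteq> graded_forms (k + 2 - 1 - 1) {s}"
      by (rule graded_forms_mono) auto
    ultimately have "ext_deriv (codiff \<eta>) \<in> graded_forms k {s}" by auto
    then show ?thesis
      using ext_deriv_ext_deriv[OF polynomial_function_codiff[OF p]]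
      by (auto simp: closed_forms_def fun_eq_iff)
  qed
  moreover have "codiff (ext_deriv \<eta>) \<in> coclosed_forms k {s}"
  proof -
    have "codiff (ext_deriv \<eta>) \<in> graded_forms (k + 2 - 1 - 1) (Suc -` Suc ` {s})"
      by (intro graded_forms_ext_deriv graded_forms_codiff \<eta>)
    moreover have "(Suc -` Suc ` {s}) = {s}" by auto
    ultimately show ?thesis
      using codiff_codiff[OF polynomial_function_ext_deriv[OF p]]
      by (simp add: coclosed_forms_def fun_eq_iff)
  qed
  ultimately show ?thesis by (rule that)
qed

text \<open>A multiple of \<open>wedge_x \<eta>\<close> is a preimage of \<open>\<eta>\<close> but
  need not be closed; its closed part from \<open>closed_coclosed_decomposition\<close> has the same
  codifferential.\<close>

lemma image_codiff_closed_forms: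
  assumes "s < CARD('n::{finite,linorder})"
  shows "codiff ` closed_forms (Suc k) {Suc s} = (coclosed_forms k {s} :: 'n form set)"
proof (intro subset_antisym subsetI)
  fix \<eta> :: "'n form" assume "\<eta> \<in> codiff ` closed_forms (Suc k) {Suc s}"
  then obtain \<omega> where \<omega>: "\<omega> \<in> graded_forms (Suc k) {Suc s}" "\<eta> = codiff \<omega>"
    by (auto simp: closed_forms_def)
  show "\<eta> \<in> coclosed_forms k {s}"
    unfolding \<omega>(2) using graded_forms_codiff[OF \<omega>(1)] codiff_codiff[OF polynomial_function_graded_forms[OF \<omega>(1)]]
    by (auto simp: coclosed_forms_def fun_eq_iff vimage_def)
next
  fix \<eta> :: "'n form" assume "\<eta> \<in> coclosed_forms k {s}"
  then have \<eta>: "\<eta> \<in> graded_forms k {s}" "codiff \<eta> = 0" by (auto simp: coclosed_forms_def)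
  define N where "N = real (k + (CARD('n) - s))"
  \<comment> \<open>This rests on \<open>s < CARD('n)\<close>: at \<open>k = 0\<close> and
    \<open>s = CARD('n)\<close> the factor would vanish.\<close>
  have N: "N \<noteq> 0" using assms by (simp add: N_def)
  have w: "wedge_x \<eta> \<in> graded_forms (Suc k) {Suc s}"
    using graded_forms_wedge_x[OF \<eta>(1)] by simp
  have "codiff (wedge_x \<eta>) x = - N *\<^sub>R \<eta> x" for x
    using codiff_wedge_x[OF \<eta>(1), of x] assms by (simp add: \<eta>(2) wedge_x_def linear_zeros N_def)
  then have c: "codiff (fun_scaleR (- 1 / N) (wedge_x \<eta>)) = \<eta>"
    unfolding graded_linear(4)[OF w] using N by (simp add: fun_eq_iff fun_scaleR_def)
  have "fun_scaleR (- 1 / N) (wedge_x \<eta>) \<in> graded_forms (Suc k) {Suc s}"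
    by (rule fun_vs.subspace_scale[OF subspace_graded_forms w])
  then obtain \<alpha> \<beta> where ab: "fun_scaleR (- 1 / N) (wedge_x \<eta>) = \<alpha> + \<beta>"
    "\<alpha> \<in> closed_forms (Suc k) {Suc s}" "\<beta> \<in> coclosed_forms (Suc k) {Suc s}"
    by (rule closed_coclosed_decomposition)
  have "\<eta> = codiff \<alpha> + codiff \<beta>"
    using c unfolding ab(1)
    by (subst (asm) graded_linear(3)) (use ab in \<open>auto simp: closed_forms_def coclosed_forms_def\<close>)
  then have "\<eta> = codiff \<alpha>" using ab(3) by (simp add: coclosed_forms_def)
  then show "\<eta> \<in> codiff ` closed_forms (Suc k) {Suc s}" using ab(2) by blast
qed

lemma dim_harmonic_forms_Suc:
  assumes "s < CARD('n::{finite,linorder})"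
  shows "fun_vs.dim (harmonic_forms (Suc k) {Suc s} :: 'n form set) +
    fun_vs.dim (coclosed_forms k {s} :: 'n form set) = fun_vs.dim (closed_forms (Suc k) {Suc s} :: 'n form set)"
  unfolding image_codiff_closed_forms[OF assms, symmetric] harmonic_forms_def
  by (rule dim_kernel_image[where k = "Suc k" and S = "{Suc s}", OF subspace_closed_forms, symmetric])
     (auto simp: closed_forms_def intro: graded_linear)

lemma choose_eq_fact:
  "n = n' \<Longrightarrow> n = i + j \<Longrightarrow> real (n choose i) = fact n' / (fact i * fact j)"
  by (auto simp: binomial_fact)

text \<open>The difference of the two counts in \<open>dim_harmonic_forms_Suc\<close>, in degree
  \<open>k + 1\<close> with \<open>s = a + 1\<close> and \<open>m = a + b + 2\<close>; these
  parameters avoid truncated subtraction. The second product counts the coclosed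
  \<open>a\<close>-forms of degree \<open>k\<close>, which \<open>star\<close> identifies with
  closed forms of form degree \<open>m - a = b + 2\<close>.\<close>

lemma harmonic_choose_identity:
  fixes a b k :: nat
  shows "real (k + 1 + (a + b + 2) choose (k + a + 2)) * real (k + a + 1 choose (k + 1)) -
      real (k + (a + b + 2) choose (k + b + 2)) * real (k + b + 1 choose k) =
    real (a + b choose a) * real (k + 1 + (a + b) choose (a + b)) *
      ((2 * (real k + 1) + real (a + b + 2)) * (real k + 1 + real (a + b + 2) - 1) /
        ((real k + 1 + real (a + 1)) * (real k + 1 + real (a + b + 2) - real (a + 1))))"
proof -
  \<comment> \<open>The product of the first two binomials on the right; what remains on both sides
    is rational in \<open>k\<close>, \<open>a\<close> and \<open>b\<close>.\<close>
  define F :: real where "F = fact (k + a + b + 1) / (fact a * fact b * fact (k + 1))"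
  have f: "fact (k + a + b + 2) = real (k + a + b + 2) * fact (k + a + b + 1)"
    "fact (k + a + b + 3) = real (k + a + b + 3) * (real (k + a + b + 2) * fact (k + a + b + 1))"
    "fact (k + a + 2) = real (k + a + 2) * fact (k + a + 1)"
    "fact (k + b + 2) = real (k + b + 2) * fact (k + b + 1)"
    "fact (b + 1) = real (b + 1) * fact b" "fact (k + 1) = real (k + 1) * fact k"
    by (simp_all add: eval_nat_numeral)
  have 1: "real (k + 1 + (a + b + 2) choose (k + a + 2)) * real (k + a + 1 choose (k + 1)) =
      F * (real (k + a + b + 3) * real (k + a + b + 2) / (real (k + a + 2) * real (b + 1)))"
  proof -
    have "real (k + 1 + (a + b + 2) choose (k + a + 2)) = fact (k + a + b + 3) / (fact (k + a + 2) * fact (b + 1))"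
      by (rule choose_eq_fact) simp_all
    moreover have "real (k + a + 1 choose (k + 1)) = fact (k + a + 1) / (fact (k + 1) * fact a)"
      by (rule choose_eq_fact) simp_all
    ultimately show ?thesis by (simp only: f F_def) (simp add: divide_simps)
  qed
  have 2: "real (k + (a + b + 2) choose (k + b + 2)) * real (k + b + 1 choose k) =
      F * (real (k + a + b + 2) * real (k + 1) / (real (k + b + 2) * real (b + 1)))"
  proof -
    have "real (k + (a + b + 2) choose (k + b + 2)) = fact (k + a + b + 2) / (fact (k + b + 2) * fact a)"
      by (rule choose_eq_fact) simp_all
    moreover have "real (k + b + 1 choose k) = fact (k + b + 1) / (fact k * fact (b + 1))"
      by (rule choose_eq_fact) simp_all
    ultimately show ?thesis by (simp only: f F_def) (simp add: divide_simps)
  qed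
  have 3: "real (a + b choose a) * real (k + 1 + (a + b) choose (a + b)) = F"
  proof -
    have "real (a + b choose a) = fact (a + b) / (fact a * fact b)"
      by (rule choose_eq_fact) simp_all
    moreover have "real (k + 1 + (a + b) choose (a + b)) = fact (k + a + b + 1) / (fact (a + b) * fact (k + 1))"
      by (rule choose_eq_fact) simp_all
    ultimately show ?thesis by (simp only: F_def) (simp add: add.commute)
  qed
  define K A B where "K = real k" and "A = real a" and "B = real b"
  have nn: "K \<ge> 0" "A \<ge> 0" "B \<ge> 0" by (simp_all add: K_def A_def B_def)
  \<comment> \<open>The cancellation is \<open>(K + A + B + 3) * (K + B + 2) - (K + 1) * (K + A + 2)
    = (B + 1) * (2 * (K + 1) + (A + B + 2))\<close>.\<close>
  have "(K + A + B + 3) * (K + A + B + 2) / ((K + A + 2) * (B + 1)) - (K + A + B + 2) * (K + 1) / ((K + B + 2) * (B + 1)) =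
      (2 * (K + 1) + (A + B + 2)) * (K + A + B + 2) / ((K + A + 2) * (K + B + 2))"
  proof -
    have nz: "K + A + 2 \<noteq> 0" "B + 1 \<noteq> 0" "K + B + 2 \<noteq> 0" using nn by linarith+
    have "(K + A + B + 3) * (K + A + B + 2) / ((K + A + 2) * (B + 1)) - (K + A + B + 2) * (K + 1) / ((K + B + 2) * (B + 1)) =
        (B + 1) * ((2 * (K + 1) + (A + B + 2)) * (K + A + B + 2)) / ((B + 1) * ((K + A + 2) * (K + B + 2)))"
      using nz by (simp add: divide_simps) algebra
    then show ?thesis using nz by simp
  qed
  then show ?thesis unfolding 1 2 3 right_diff_distrib[symmetric]
    by (simp add: K_def A_def B_def algebra_simps)
qed

lemma dim_harmonic_forms:
  assumes "s \<le> CARD('n::{finite,linorder})"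
  shows "real (fun_vs.dim (harmonic_forms k {s} :: 'n form set)) = dim_formula (int k) CARD('n) s"
proof (cases k)
  case 0
  \<comment> \<open>With constant coefficients every form is closed and coclosed, so the count is
    \<open>CARD('n) choose s\<close>.\<close>
  have "harmonic_forms 0 {s} = (graded_forms 0 {s} :: 'n form set)"
    using ext_deriv_degree_0 codiff_degree_0 by (auto simp: harmonic_forms_def closed_forms_def)
  then have d: "fun_vs.dim (harmonic_forms k {s} :: 'n form set) = CARD('n) choose s"
    using 0 by (simp add: dim_graded_forms_single)
  show ?thesis
  proof (cases "1 \<le> s \<and> s < CARD('n)")
    case True
    define a b where "a = s - 1" and "b = CARD('n) - s - 1"
    have ab: "s = a + 1" "CARD('n) = a + b + 2" using True by (auto simp: a_def b_def)
    have "real (a + b + 2 choose (a + 1)) = fact (a + b + 2) / (fact (a + 1) * fact (b + 1))"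
      by (rule choose_eq_fact) simp_all
    moreover have "real (a + b choose a) = fact (a + b) / (fact a * fact b)"
      by (rule choose_eq_fact) simp_all
    moreover have "fact (a + b + 2) = real (a + b + 2) * (real (a + b + 1) * fact (a + b))"
      "fact (a + 1) = real (a + 1) * fact a" "fact (b + 1) = real (b + 1) * fact b"
      by (simp_all add: eval_nat_numeral)
    ultimately have "real (a + b + 2 choose (a + 1)) =
        real (a + b choose a) * (real (a + b + 2) * (real (a + b + 2) - 1) / (real (a + 1) * (real (a + b + 2) - real (a + 1))))"
      by (simp only:) (simp add: divide_simps)
    then show ?thesis unfolding d using 0 True by (simp add: dim_formula_def ab)
  next
    case False
    then have "s = 0 \<or> s = CARD('n)" using assms by auto
    then show ?thesis unfolding d using 0 False by (auto simp: dim_formula_def)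
  qed
next
  case (Suc k')
  show ?thesis
  proof (cases s)
    case 0
    \<comment> \<open>Functions are coclosed for lack of a lower form degree, and in positive degree
      \<open>dim_closed_forms\<close> gives 0 for them.\<close>
    have "codiff \<omega> = 0" if "\<omega> \<in> graded_forms k {0}" for \<omega> :: "'n form"
      using graded_forms_component(2)[OF graded_forms_codiff[OF that]] by (simp add: fun_eq_iff vec_eq_iff)
    then have "harmonic_forms k {s} = (closed_forms k {s} :: 'n form set)"
      using 0 by (auto simp: harmonic_forms_def closed_forms_def)
    then show ?thesis using 0 Suc by (simp add: dim_closed_forms dim_formula_def)
  next
    case s: (Suc a)
    have "fun_vs.dim (harmonic_forms k {s} :: 'n form set) + fun_vs.dim (coclosed_forms k' {a} :: 'n form set) =
        fun_vs.dim (closed_forms k {s} :: 'n form set)"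
      unfolding Suc s by (rule dim_harmonic_forms_Suc) (use s assms in simp)
    then have *: "real (fun_vs.dim (harmonic_forms k {s} :: 'n form set)) =
        real (k + CARD('n) choose (k + s)) * real (k + s - 1 choose k) -
        real (k' + CARD('n) choose (k' + (CARD('n) - a))) * real (k' + (CARD('n) - a) - 1 choose k')"
      using assms s by (simp add: dim_closed_forms dim_coclosed_forms flip: of_nat_mult of_nat_add)
    show ?thesis
    proof (cases "s < CARD('n)")
      case True
      define b where "b = CARD('n) - s - 1"
      have ab: "CARD('n) = a + b + 2" using True s by (auto simp: b_def)
      have "dim_formula (int k) CARD('n) s = real (a + b choose a) * real (k' + 1 + (a + b) choose (a + b)) *
          ((2 * (real k' + 1) + real (a + b + 2)) * (real k' + 1 + real (a + b + 2) - 1) /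
            ((real k' + 1 + real (a + 1)) * (real k' + 1 + real (a + b + 2) - real (a + 1))))"
        unfolding dim_formula_def ab Suc s nat_int of_int_of_nat_eq by (simp add: add.commute)
      moreover have "k + (a + b + 2) = k' + 1 + (a + b + 2)" "k + s = k' + a + 2" "k + s - 1 = k' + a + 1" "k = k' + 1"
        "k' + (a + b + 2 - a) = k' + b + 2" "k' + (a + b + 2 - a) - 1 = k' + b + 1"
        using Suc s by auto
      ultimately show ?thesis
        unfolding * ab using harmonic_choose_identity[of k' a b] by metis
    next
      case False
      \<comment> \<open>In top form degree the closed forms of degree \<open>k\<close> and the
        coclosed \<open>a\<close>-forms of degree \<open>k'\<close> have equal dimensions, so the
        difference is 0.\<close>
      then have "CARD('n) = Suc a" using assms s by simp
      then show ?thesis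
        unfolding * by (simp add: Suc s dim_formula_def binomial_symmetric[of "Suc k'" "Suc (k' + a)"] del: binomial_Suc_Suc)
    qed
  qed
qed

subsection \<open>Mixed forms\<close>

definition degree_part :: "nat \<Rightarrow> 'n::finite exterior \<Rightarrow> 'n exterior" where
  "degree_part t v = (\<chi> I. if card I = t then v $ I else 0)"

definition form_part :: "nat \<Rightarrow> 'n::finite form \<Rightarrow> 'n form" where
  "form_part t \<omega> = (\<lambda>x. degree_part t (\<omega> x))"

lemma linear_degree_part: "linear (degree_part t)"
  by (intro linearI) (auto simp: degree_part_def vec_eq_iff algebra_simps)

lemma bounded_linear_degree_part: "bounded_linear (degree_part t)"
  using linear_degree_part linear_conv_bounded_linear by blast

lemma wedge_dx_degree_part: "wedge_dx i (degree_part t v) = degree_part (Suc t) (wedge_dx i v)"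
proof -
  have "card (I - {i}) = t \<longleftrightarrow> card I = Suc t" if "i \<in> I" for I :: "'a set"
    using card.remove[OF _ that] by simp
  then show ?thesis by (auto simp: vec_eq_iff wedge_dx_def degree_part_def)
qed

lemma contract_degree_part: "contract i (degree_part (Suc t) v) = degree_part t (contract i v)"
  by (auto simp: vec_eq_iff contract_def degree_part_def)

lemma ext_deriv_form_part:
  assumes "polynomial_function \<omega>"
  shows "ext_deriv (form_part t \<omega>) = form_part (Suc t) (ext_deriv \<omega>)"
  by (rule ext) (simp add: ext_deriv_def form_part_def linear_sum[OF linear_degree_part] wedge_dx_degree_part
      partial_deriv_bounded_linear_poly[OF bounded_linear_degree_part assms])

lemma codiff_form_part:
  assumes "polynomial_function \<omega>"
  shows "codiff (form_part (Suc t) \<omega>) = form_part t (codiff \<omega>)"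
  by (rule ext) (simp add: codiff_def form_part_def linear_sum[OF linear_degree_part] contract_degree_part
      linear_neg[OF linear_degree_part] partial_deriv_bounded_linear_poly[OF bounded_linear_degree_part assms])

lemma codiff_zero: "codiff 0 = 0"
  using codiff_degree_0[OF fun_vs.subspace_0[OF subspace_graded_forms]] .

lemma ext_deriv_zero: "ext_deriv 0 = 0"
  using ext_deriv_degree_0[OF fun_vs.subspace_0[OF subspace_graded_forms]] .

lemma form_part_add: "form_part t (\<omega> + \<eta>) = form_part t \<omega> + form_part t \<eta>"
  by (simp add: fun_eq_iff form_part_def linear_add[OF linear_degree_part])

lemma form_part_scale: "form_part t (fun_scaleR c \<omega>) = fun_scaleR c (form_part t \<omega>)"
  by (simp add: fun_eq_iff form_part_def fun_scaleR_def linear_scale[OF linear_degree_part])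

lemma form_part_0: "form_part t 0 = 0"
  by (simp add: fun_eq_iff form_part_def linear_0[OF linear_degree_part])

lemma graded_forms_form_part:
  assumes "\<omega> \<in> graded_forms k S"
  shows "form_part t \<omega> \<in> graded_forms k {t}"
proof (rule graded_formsI)
  show "(\<lambda>x. form_part t \<omega> x $ I) \<in> homogeneous_polys k" for I
    using graded_forms_component(1)[OF assms, of I] homogeneous_polys_0[of k]
    by (cases "card I = t") (simp_all add: form_part_def degree_part_def)
qed (simp add: form_part_def degree_part_def)

lemma form_part_absent: "\<omega> \<in> graded_forms k S \<Longrightarrow> t \<notin> S \<Longrightarrow> form_part t \<omega> = 0"
  by (auto simp: fun_eq_iff vec_eq_iff form_part_def degree_part_def graded_forms_def)

lemma form_part_id: "\<omega> \<in> graded_forms k {t} \<Longrightarrow> form_part t \<omega> = \<omega>"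
  by (auto simp: fun_eq_iff vec_eq_iff form_part_def degree_part_def graded_forms_def)

definition mixed_degrees :: "nat \<Rightarrow> nat \<Rightarrow> nat \<Rightarrow> nat set" where
  "mixed_degrees r p q = (\<lambda>j. r + 2 * j) ` {p..q}"

text \<open>Distinct \<open>j\<close> give distinct form degrees, so \<open>form_part\<close>
  recovers the summands, and their existence becomes a condition on which coefficients
  vanish.\<close>

lemma mixed_poly_forms_eq: "mixed_poly_forms r p q k = graded_forms k (mixed_degrees r p q)"
proof (intro subset_antisym subsetI)
  fix \<omega> :: "'a form" assume "\<omega> \<in> mixed_poly_forms r p q k"
  then obtain \<eta> where \<eta>: "\<omega> = (\<lambda>x. \<Sum>j=p..q. \<eta> j x)" "\<And>j. j \<in> {p..q} \<Longrightarrow> \<eta> j \<in> graded_forms k {r + 2 * j}"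
    by (auto simp: mixed_poly_forms_def poly_forms_eq)
  show "\<omega> \<in> graded_forms k (mixed_degrees r p q)"
    unfolding \<eta>(1)
  proof (rule graded_forms_sum)
    fix j assume j: "j \<in> {p..q}"
    have "graded_forms k {r + 2 * j} \<subseteq> (graded_forms k (mixed_degrees r p q) :: 'a form set)"
      using j by (intro graded_forms_mono) (auto simp: mixed_degrees_def)
    then show "\<eta> j \<in> graded_forms k (mixed_degrees r p q)" using \<eta>(2)[OF j] by auto
  qed
next
  fix \<omega> :: "'a form" assume \<omega>: "\<omega> \<in> graded_forms k (mixed_degrees r p q)"
  have "\<omega> x $ I = (\<Sum>j=p..q. form_part (r + 2 * j) \<omega> x) $ I" for x I
  proof (cases "card I \<in> mixed_degrees r p q")
    case True
    then obtain l where l: "l \<in> {p..q}" "card I = r + 2 * l" by (auto simp: mixed_degrees_def)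
    have "(\<Sum>j=p..q. form_part (r + 2 * j) \<omega> x) $ I = (\<Sum>j=p..q. if j = l then \<omega> x $ I else 0)"
      unfolding sum_component by (rule sum.cong) (auto simp: form_part_def degree_part_def l(2))
    then show ?thesis using l(1) by simp
  next
    case False
    then have "(\<Sum>j=p..q. form_part (r + 2 * j) \<omega> x) $ I = 0"
      unfolding sum_component by (intro sum.neutral) (auto simp: form_part_def degree_part_def mixed_degrees_def)
    then show ?thesis using graded_forms_component(2)[OF \<omega> False] by simp
  qed
  then have "\<omega> = (\<lambda>x. \<Sum>j=p..q. form_part (r + 2 * j) \<omega> x)"
    unfolding fun_eq_iff vec_eq_iff by blast
  then show "\<omega> \<in> mixed_poly_forms r p q k"
    unfolding mixed_poly_forms_def poly_forms_eq using graded_forms_form_part[OF \<omega>]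
    by (intro CollectI exI[of _ "\<lambda>j. form_part (r + 2 * j) \<omega>"]) auto
qed

section \<open>Solutions and the links between their parts\<close>

lemma MT_eq:
  "MT r p q k = {P \<in> graded_forms k (mixed_degrees r p q). ext_deriv P + codiff P = 0}"
  by (auto simp: MT_def mixed_poly_forms_eq fun_eq_iff)

lemma subspace_MT: "fun_vs.subspace (MT r p q k)"
  unfolding MT_eq
proof (rule fun_vs_pair.subspace_kernel_on[OF subspace_graded_forms])
  fix P Q :: "'a form" and c
  assume "P \<in> graded_forms k (mixed_degrees r p q)"
  then show "ext_deriv (fun_scaleR c P) + codiff (fun_scaleR c P) = fun_scaleR c (ext_deriv P + codiff P)"
    by (simp add: graded_linear fun_vs.scale_right_distrib)
  assume "Q \<in> graded_forms k (mixed_degrees r p q)"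
  with \<open>P \<in> _\<close> show "ext_deriv (P + Q) + codiff (P + Q) = (ext_deriv P + codiff P) + (ext_deriv Q + codiff Q)"
    by (simp add: graded_linear)
qed

text \<open>Form degree \<open>t + 1\<close> of the equation receives only the part of degree
  \<open>t\<close> through \<open>ext_deriv\<close> and that of degree \<open>t + 2\<close> through
  \<open>codiff\<close>. Since \<open>t\<close> is not tied to the degrees of \<open>P\<close>, the
  values just outside them give boundary conditions.\<close>

lemma MT_form_part:
  assumes "P \<in> MT r p q k"
  shows "ext_deriv (form_part t P) = - codiff (form_part (t + 2) P)"
proof -
  have P: "polynomial_function P" "ext_deriv P + codiff P = 0"
    using assms polynomial_function_graded_forms by (auto simp: MT_eq)
  have "form_part (Suc t) (ext_deriv P) + form_part (Suc t) (codiff P) = 0"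
    unfolding form_part_add[symmetric] P(2) by (rule form_part_0)
  then show ?thesis
    using ext_deriv_form_part[OF P(1), of t] codiff_form_part[OF P(1), of "Suc t"]
    by (simp add: eq_neg_iff_add_eq_0)
qed

lemma MT_single: "MT r p p k = harmonic_forms k {r + 2 * p}"
proof (intro subset_antisym subsetI)
  fix P :: "'a form" assume P: "P \<in> MT r p p k"
  then have g: "P \<in> graded_forms k {r + 2 * p}" and e: "ext_deriv P + codiff P = 0"
    by (auto simp: MT_eq mixed_degrees_def)
  \<comment> \<open>Only the upward link is used. Coclosedness then follows from the equation
    itself, which also covers the form degrees 0 and 1, not of the shape
    \<open>t + 2\<close>.\<close>
  have "ext_deriv P = 0"
    using MT_form_part[OF P, of "r + 2 * p"] form_part_id[OF g] form_part_absent[OF g, of "r + 2 * p + 2"]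
    by (simp add: codiff_zero)
  then show "P \<in> harmonic_forms k {r + 2 * p}"
    using g e by (simp add: harmonic_forms_def closed_forms_def)
qed (simp add: harmonic_forms_def closed_forms_def MT_eq mixed_degrees_def)

lemma mixed_degrees_Suc: "p \<le> q \<Longrightarrow> mixed_degrees r p (Suc q) = insert (r + 2 * q + 2) (mixed_degrees r p q)"
  unfolding mixed_degrees_def by (subst atLeastAtMostSuc_conv) auto

lemma graded_forms_Diff_form_part:
  assumes "\<omega> \<in> graded_forms k (insert t S)" "form_part t \<omega> = 0"
  shows "\<omega> \<in> graded_forms k S"
proof (rule graded_formsI)
  show "(\<lambda>x. \<omega> x $ I) \<in> homogeneous_polys k" for I by (rule graded_forms_component(1)[OF assms(1)])
  show "\<omega> x $ I = 0" if "card I \<notin> S" for I x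
  proof (cases "card I = t")
    case True
    then show ?thesis
      using arg_cong[OF fun_cong[OF assms(2), of x], of "\<lambda>v. v $ I"]
      by (simp add: form_part_def degree_part_def)
  next
    case False
    then show ?thesis using graded_forms_component(2)[OF assms(1), of I] that by simp
  qed
qed

(* Surjectivity: contraction and exterior multiplication with the Euler field turn a closed and
   coclosed form into the parts of degree r + 2q and r + 2q + 2 of a solution. *)
lemma image_MT_link:
  fixes r p q k :: nat
  assumes pq: "p \<le> q" and t: "r + 2 * q + 2 \<le> CARD('n::{finite,linorder})"
  shows "(\<lambda>P. ext_deriv (form_part (r + 2 * q) P)) ` MT r p (Suc q) (Suc k) =
    (harmonic_forms k {r + 2 * q + 1} :: 'n form set)"
proof (intro subset_antisym subsetI)
  fix \<eta> :: "'n form" assume "\<eta> \<in> (\<lambda>P. ext_deriv (form_part (r + 2 * q) P)) ` MT r p (Suc q) (Suc k)"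
  then obtain P where P: "P \<in> MT r p (Suc q) (Suc k)" "\<eta> = ext_deriv (form_part (r + 2 * q) P)" by blast
  then have "P \<in> graded_forms (Suc k) (mixed_degrees r p (Suc q))" by (simp add: MT_eq)
  then have parts: "form_part t P \<in> graded_forms (Suc k) {t}" for t by (rule graded_forms_form_part)
  \<comment> \<open>As minus the codifferential of the upper part, the link is coclosed as well as
    closed.\<close>
  have "\<eta> = - codiff (form_part (r + 2 * q + 2) P)"
    unfolding P(2) by (rule MT_form_part[OF P(1)])
  also have "\<dots> = codiff (fun_scaleR (- 1) (form_part (r + 2 * q + 2) P))"
    using codiff_scale[OF polynomial_function_graded_forms[OF parts], of "- 1" "r + 2 * q + 2"]
    by (simp only: fun_vs.scale_minus_left fun_vs.scale_one)
  finally have \<eta>: "\<eta> = codiff (fun_scaleR (- 1) (form_part (r + 2 * q + 2) P))" .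
  have "codiff \<eta> = 0"
    unfolding \<eta> fun_eq_iff zero_fun_def
    by (intro allI codiff_codiff polynomial_function_graded_forms[OF fun_vs.subspace_scale[OF subspace_graded_forms parts]])
  moreover have "\<eta> \<in> closed_forms k {r + 2 * q + 1}"
    using image_ext_deriv[of k "r + 2 * q"] parts[of "r + 2 * q"] by (auto simp: P(2))
  ultimately show "\<eta> \<in> harmonic_forms k {r + 2 * q + 1}" by (simp add: harmonic_forms_def)
next
  fix \<eta> :: "'n form" assume "\<eta> \<in> harmonic_forms k {r + 2 * q + 1}"
  then have \<eta>: "\<eta> \<in> graded_forms k {r + 2 * q + 1}" "ext_deriv \<eta> = 0" "codiff \<eta> = 0"
    by (auto simp: harmonic_forms_def closed_forms_def)
  \<comment> \<open>The homotopy factors of \<open>contract_x\<close> and \<open>wedge_x\<close> in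
    form degree \<open>r + 2 * q + 1\<close>; \<open>N\<close> is nonzero because this degree is
    below \<open>CARD('n)\<close>.\<close>
  define M N where "M = real (k + (r + 2 * q + 1))" and "N = real (k + (CARD('n) - (r + 2 * q + 1)))"
  have MN: "M \<noteq> 0" "N \<noteq> 0" using t by (auto simp: M_def N_def)
  have c: "contract_x \<eta> \<in> graded_forms (Suc k) {r + 2 * q}"
    using graded_forms_contract_x[OF \<eta>(1)] by (simp add: vimage_def)
  have w: "wedge_x \<eta> \<in> graded_forms (Suc k) {r + 2 * q + 2}"
    using graded_forms_wedge_x[OF \<eta>(1)] by simp
  define \<alpha> \<beta> where "\<alpha> = fun_scaleR (1 / M) (contract_x \<eta>)" and "\<beta> = fun_scaleR (1 / N) (wedge_x \<eta>)"
  have \<alpha>: "\<alpha> \<in> graded_forms (Suc k) {r + 2 * q}" and \<beta>: "\<beta> \<in> graded_forms (Suc k) {r + 2 * q + 2}"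
    unfolding \<alpha>_def \<beta>_def using fun_vs.subspace_scale[OF subspace_graded_forms] c w by blast+
  note p = polynomial_function_graded_forms[OF \<eta>(1)]
  have zero: "contract_x 0 = 0" "wedge_x 0 = 0"
    by (simp_all add: contract_x_def wedge_x_def linear_zeros fun_eq_iff)
  \<comment> \<open>\<open>\<alpha>\<close> is coclosed and \<open>\<beta>\<close> will be closed,
    so the only link of \<open>\<alpha> + \<beta>\<close> is the one between them, where
    \<open>\<eta>\<close> and \<open>- \<eta>\<close> cancel.\<close>
  have d\<alpha>: "ext_deriv \<alpha> = \<eta>" "codiff \<alpha> = 0"
    unfolding \<alpha>_def graded_linear(2)[OF c] graded_linear(4)[OF c]
    using ext_deriv_contract_x[OF \<eta>(1)] codiff_contract_x[OF p] MN
    by (simp_all add: \<eta>(2,3) zero fun_eq_iff fun_scaleR_def M_def)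
  have "codiff (wedge_x \<eta>) x = - N *\<^sub>R \<eta> x" for x
    using codiff_wedge_x[OF \<eta>(1), of x] t by (simp add: \<eta>(3) zero N_def)
  then have d\<beta>: "ext_deriv \<beta> = 0" "codiff \<beta> = - \<eta>"
    unfolding \<beta>_def graded_linear(2)[OF w] graded_linear(4)[OF w]
    using ext_deriv_wedge_x[OF p] MN
    by (simp_all add: \<eta>(2) zero fun_eq_iff fun_scaleR_def)
  have mem: "r + 2 * q \<in> mixed_degrees r p q" using pq by (simp add: mixed_degrees_def)
  have "graded_forms (Suc k) {r + 2 * q} \<subseteq> (graded_forms (Suc k) (mixed_degrees r p (Suc q)) :: 'n form set)"
    "graded_forms (Suc k) {r + 2 * q + 2} \<subseteq> (graded_forms (Suc k) (mixed_degrees r p (Suc q)) :: 'n form set)"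
    by (rule graded_forms_mono, simp add: mixed_degrees_Suc[OF pq] mem)+
  then have "\<alpha> + \<beta> \<in> graded_forms (Suc k) (mixed_degrees r p (Suc q))"
    using \<alpha> \<beta> by (intro fun_vs.subspace_add[OF subspace_graded_forms]) auto
  moreover have "ext_deriv (\<alpha> + \<beta>) + codiff (\<alpha> + \<beta>) = 0"
    unfolding graded_linear(1)[OF \<alpha> \<beta>] graded_linear(3)[OF \<alpha> \<beta>] by (simp add: d\<alpha> d\<beta>)
  ultimately have "\<alpha> + \<beta> \<in> MT r p (Suc q) (Suc k)" by (simp add: MT_eq)
  moreover have "form_part (r + 2 * q) (\<alpha> + \<beta>) = \<alpha>"
    using form_part_id[OF \<alpha>] form_part_absent[OF \<beta>, of "r + 2 * q"] by (simp add: form_part_add)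
  ultimately show "\<eta> \<in> (\<lambda>P. ext_deriv (form_part (r + 2 * q) P)) ` MT r p (Suc q) (Suc k)"
    using d\<alpha>(1) by (metis imageI)
qed

text \<open>Two rank-nullity counts. The first is for the link \<open>f\<close> between the top two
  parts, with kernel \<open>L\<close>; the second is for the top part on \<open>L\<close>, which is
  closed and coclosed once the link vanishes. What the second map kills are the solutions without
  the top degree.\<close>

lemma dim_MT_Suc:
  fixes r p q k :: nat
  assumes pq: "p \<le> q" and t: "r + 2 * q + 2 \<le> CARD('n::{finite,linorder})"
  shows "real (fun_vs.dim (MT r p (Suc q) k :: 'n form set)) = fun_vs.dim (MT r p q k :: 'n form set) +
    dim_formula (int k) CARD('n) (r + 2 * q + 2) + dim_formula (int k - 1) CARD('n) (r + 2 * q + 1)"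
proof -
  define t where "t = r + 2 * q"
  define f :: "'n form \<Rightarrow> 'n form" where "f P = ext_deriv (form_part t P)" for P
  define L where "L = {P \<in> (MT r p (Suc q) k :: 'n form set). f P = 0}"
  have graded: "P \<in> graded_forms k (insert (t + 2) (mixed_degrees r p q))" if "P \<in> MT r p (Suc q) k" for P :: "'n form"
    using that mixed_degrees_Suc[OF pq, of r] by (auto simp: MT_eq t_def)
  then have MT_graded: "(MT r p (Suc q) k :: 'n form set) \<subseteq> graded_forms k (insert (t + 2) (mixed_degrees r p q))"
    by blast
  have parts: "form_part s P \<in> graded_forms k {s}" if "P \<in> MT r p (Suc q) k" for s and P :: "'n form"
    using graded_forms_form_part[OF graded[OF that]] .
  have f_add: "f (P + Q) = f P + f Q" if "P \<in> MT r p (Suc q) k" "Q \<in> MT r p (Suc q) k" for P Q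
    unfolding f_def form_part_add by (rule graded_linear(1)[OF parts parts]) (fact that)+
  have f_scale: "f (fun_scaleR c P) = fun_scaleR c (f P)" if "P \<in> MT r p (Suc q) k" for P c
    unfolding f_def form_part_scale by (rule graded_linear(2)[OF parts]) (fact that)
  \<comment> \<open>The second exclusion says that no part lies above the top one, whose exterior
    derivative therefore vanishes.\<close>
  have notin: "t + 2 \<notin> mixed_degrees r p q" "t + 2 + 2 \<notin> insert (t + 2) (mixed_degrees r p q)"
    by (auto simp: mixed_degrees_def t_def)
  have image_f: "real (fun_vs.dim (f ` MT r p (Suc q) k)) = dim_formula (int k - 1) CARD('n) (t + 1)"
  proof (cases k)
    \<comment> \<open>Constant coefficients have no links, in agreement with the value 0 of
      \<open>dim_formula\<close> at -1.\<close>
    case 0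
    have "f P = 0" if "P \<in> MT r p (Suc q) k" for P
      unfolding f_def using parts[OF that] 0 by (intro ext_deriv_degree_0) simp
    moreover have "0 \<in> (MT r p (Suc q) k :: 'n form set)" by (rule fun_vs.subspace_0[OF subspace_MT])
    ultimately have "f ` MT r p (Suc q) k = {0}" by (auto simp: image_iff intro!: bexI[of _ 0])
    then show ?thesis using 0 by (simp add: fun_vs_dim_0 dim_formula_def)
  next
    case (Suc k')
    have "f ` MT r p (Suc q) k = harmonic_forms k' {t + 1}"
      using image_MT_link[OF assms, of k'] Suc by (simp add: f_def t_def)
    then show ?thesis using dim_harmonic_forms[where 'n = 'n, of "t + 1" k'] assms Suc by (simp add: t_def)
  qed
  have kernel: "{P \<in> L. form_part (t + 2) P = 0} = MT r p q k"
  proof (intro subset_antisym subsetI)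
    fix P assume P: "P \<in> {P \<in> L. form_part (t + 2) P = 0}"
    then have "P \<in> graded_forms k (mixed_degrees r p q)"
      using graded[of P] graded_forms_Diff_form_part[of P k "t + 2"] by (auto simp: L_def)
    then show "P \<in> MT r p q k" using P by (simp add: L_def MT_eq)
  next
    fix P :: "'n form" assume P: "P \<in> MT r p q k"
    then have "P \<in> graded_forms k (mixed_degrees r p q)" by (simp add: MT_eq)
    then have 0: "form_part (t + 2) P = 0" using notin(1) by (rule form_part_absent)
    \<comment> \<open>The link can be read off from its upper end, and there the part is
      zero.\<close>
    have "f P = 0" unfolding f_def MT_form_part[OF P] 0 by (simp add: codiff_zero)
    moreover have "P \<in> MT r p (Suc q) k"
      using P graded_forms_mono[of "mixed_degrees r p q" "mixed_degrees r p (Suc q)" k]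
      by (auto simp: MT_eq mixed_degrees_Suc[OF pq])
    ultimately show "P \<in> {P \<in> L. form_part (t + 2) P = 0}" using 0 by (simp add: L_def)
  qed
  have image: "form_part (t + 2) ` L = harmonic_forms k {t + 2}"
  proof (intro subset_antisym subsetI)
    fix \<eta> assume "\<eta> \<in> form_part (t + 2) ` L"
    then obtain P where P: "P \<in> MT r p (Suc q) k" "f P = 0" and \<eta>: "\<eta> = form_part (t + 2) P"
      by (auto simp: L_def)
    have "codiff \<eta> = 0" using MT_form_part[OF P(1), of t] P(2) by (simp add: f_def \<eta>)
    moreover have "ext_deriv \<eta> = 0"
      using MT_form_part[OF P(1), of "t + 2"] form_part_absent[OF graded[OF P(1)] notin(2)]
      by (simp add: \<eta> codiff_zero)
    ultimately show "\<eta> \<in> harmonic_forms k {t + 2}"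
      using parts[OF P(1)] by (simp add: \<eta> harmonic_forms_def closed_forms_def)
  next
    fix \<eta> :: "'n form" assume "\<eta> \<in> harmonic_forms k {t + 2}"
    then have \<eta>: "\<eta> \<in> graded_forms k {t + 2}" "ext_deriv \<eta> = 0" "codiff \<eta> = 0"
      by (auto simp: harmonic_forms_def closed_forms_def)
    have "graded_forms k {t + 2} \<subseteq> (graded_forms k (mixed_degrees r p (Suc q)) :: 'n form set)"
      by (rule graded_forms_mono) (simp add: mixed_degrees_Suc[OF pq] t_def)
    then have "\<eta> \<in> MT r p (Suc q) k" using \<eta> by (auto simp: MT_eq)
    moreover have "f \<eta> = 0"
      using form_part_absent[OF \<eta>(1), of t] by (simp add: f_def ext_deriv_zero)
    ultimately have "\<eta> \<in> L" by (simp add: L_def)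
    then have "form_part (t + 2) \<eta> \<in> form_part (t + 2) ` L" by (rule imageI)
    then show "\<eta> \<in> form_part (t + 2) ` L" unfolding form_part_id[OF \<eta>(1)] .
  qed
  have "fun_vs.subspace L"
    unfolding L_def by (rule fun_vs_pair.subspace_kernel_on[OF subspace_MT]) (auto simp: f_add f_scale)
  then have "fun_vs.dim L = fun_vs.dim {P \<in> L. form_part (t + 2) P = 0} + fun_vs.dim (form_part (t + 2) ` L)"
    using MT_graded by (intro dim_kernel_image) (auto simp: L_def form_part_add form_part_scale)
  then have "fun_vs.dim L = fun_vs.dim (MT r p q k :: 'n form set) + fun_vs.dim (harmonic_forms k {t + 2} :: 'n form set)"
    unfolding kernel image .
  moreover have "fun_vs.dim (MT r p (Suc q) k :: 'n form set) = fun_vs.dim L + fun_vs.dim (f ` MT r p (Suc q) k)"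
    unfolding L_def by (rule dim_kernel_image[OF subspace_MT MT_graded]) (auto simp: f_add f_scale)
  ultimately show ?thesis
    using image_f dim_harmonic_forms[where 'n = 'n, of "t + 2" k] assms(2) by (simp add: t_def)
qed

theorem corollary1:
  fixes r p q k :: nat
  assumes "p \<le> q" and "r + 2 * q \<le> CARD('n::{finite,linorder})"
  shows "real (fun_vs.dim (MT r p q k :: 'n form set)) =
    (\<Sum>j=p..q. dim_formula (int k) CARD('n) (r + 2 * j)) +
    (\<Sum>j=p..<q. dim_formula (int k - 1) CARD('n) (r + 2 * j + 1))"
  using assms
proof (induction q rule: dec_induct)
  case base
  then show ?case by (simp add: MT_single dim_harmonic_forms)
next
  case (step q)
  then show ?case using dim_MT_Suc[where 'n = 'n, of p q r k]
    by (simp add: atLeastAtMostSuc_conv atLeastLessThanSuc)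
qed

end
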